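(* Consider the stochastic first-order method described in the context where, at iteration $k$, the proximal function is $\phi_k=\delta_{\{\mathbf z:\|\mathbf z\|_1\le\psi_k\}}$ (the indicator function of the $\ell_1$-ball of radius $\psi_k>0$, where $\psi_k$ may change across iterations), with minibatch gradient estimates $G^k=\frac1{m_k}\sum_{i=1}^{m_k}G(\mathbf x^k,\zeta_i^k)$, and suppose the standing assumptions in the context hold. Let $\eta_k=\eta>0$ for all $k$ and $p_k=\psi_k/\sum_{j=1}^K\psi_j$. Then $$\mathbb E\big[\mathrm{dist}_{\|\cdot\|_\infty}(0,\partial(f+\delta_X)(\mathbf x^{Y+1}))\big]\le\left(\frac{3L}2+\frac1\eta\right)\frac{\sum_{k=1}^K\psi_k^2}{\sum_{k=1}^K\psi_k}+\frac{\Delta_f}{\sum_{k=1}^K\psi_k}+\frac{2\sum_{k=1}^K\frac{\psi_k}{\sqrt{m_k}}}{\sum_{k=1}^K\psi_k}\sqrt{e^2(\log d)\sigma_\infty^2}.$$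
   Context: Problem: minimize $f(\mathbf x)=\mathbb E[F(\mathbf x,\zeta)]$ over $\mathbf x\in X$, where $X\subseteq\mathbb R^d$ ($d\ge2$) is nonempty, closed and convex, $\zeta$ is a random vector with values in $\Xi$, $f:\mathbb R^d\to\mathbb R$ is well defined, finite and everywhere differentiable (possibly nonconvex). $\|\cdot\|$ is the Euclidean norm. There is a measurable $G:X\times\Xi\to\mathbb R^d$ (stochastic first-order oracle, which can be evaluated at any $(\mathbf x,\zeta)$) with $\mathbb E[G(\mathbf x,\zeta)]=\nabla f(\mathbf x)$ for all $\mathbf x\in X$. Standing assumptions: (i) $\sigma_\infty^2:=\max_{\mathbf x\in X}\mathbb E[\|G(\mathbf x,\zeta)-\nabla f(\mathbf x)\|_\infty^2]<\infty$; (ii) for a constant $L\ge0$, $\|\nabla f(\mathbf x)-\nabla f(\mathbf y)\|_\infty\le L\|\mathbf x-\mathbf y\|_1$ for all $\mathbf x,\mathbf y\in X$; (iii) $f(\mathbf x)\ge\underline f$ for all $\mathbf x\in X$, for some $\underline f\in\mathbb R$. Algorithm: choose $\mathbf x^1\in X$ and a positive integer $K$. For $k=1,\dots,K$: form a gradient estimate $G^k$ and set $$\mathbf x^{k+1}=\arg\min_{\mathbf x\in X}\left\{\tfrac12\|\mathbf x-(\mathbf x^k-\eta_kG^k)\|^2+\phi_k(\mathbf x-\mathbf x^k)\right\}.$$ Output $\mathbf x^{Y+1}$, where $Y$ is a random index, independent of everything else, with $\mathbb P[Y=k]=p_k$, $k=1,\dots,K$. In the minibatch estimate, $m_k$ are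 positive integers and the $\zeta_i^k$ are i.i.d. copies of $\zeta$, drawn afresh at each iteration (independent of the past). Notation: $\Delta_f=\mathbb E[f(\mathbf x^1)]-\underline f$. For a set $S$, $\delta_S$ is its indicator function ($0$ on $S$, $+\infty$ off $S$), $\partial$ is the Fréchet subdifferential, so for $\mathbf x\in X$, $\partial(f+\delta_X)(\mathbf x)=\nabla f(\mathbf x)+N_X(\mathbf x)$ with $N_X$ the normal cone, and $\mathrm{dist}_{\|\cdot\|_\infty}(0,S)=\inf\{\|\mathbf v\|_\infty:\mathbf v\in S\}$. *)

theory Defs
  imports "HOL-Probability.Probability"
begin

definition l1norm :: "real ^ 'n \<Rightarrow> real" where
  "l1norm x = (\<Sum>i\<in>UNIV. \<bar>x $ i\<bar>)"

definition delta :: "'a set \<Rightarrow> 'a \<Rightarrow> ereal" where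
  "delta S x = (if x \<in> S then 0 else \<infinity>)"

definition frechet_subdiff :: "('a::real_inner \<Rightarrow> ereal) \<Rightarrow> 'a \<Rightarrow> 'a set" where
  "frechet_subdiff h x =
    {v. \<bar>h x\<bar> \<noteq> \<infinity> \<and>
        0 \<le> Liminf (at x) (\<lambda>y. (h y - h x - ereal (v \<bullet> (y - x))) / ereal (norm (y - x)))}"

text \<open>
  The distance is the usual one only for nonempty \<open>S\<close>: as a real infimum it is unspecified
  for \<open>S = {}\<close>. For differentiable \<open>f\<close> and \<open>x \<in> X\<close>, the subdifferential of \<open>f + delta X\<close> at
  \<open>x\<close> contains the gradient of \<open>f\<close>, hence is nonempty.
\<close>
definition infdist0 :: "('a::euclidean_space) set \<Rightarrow> real" where
  "infdist0 S = (INF v\<in>S. infnorm v)"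

definition prox_step ::
    "(real ^ 'n) set \<Rightarrow> real \<Rightarrow> (real ^ 'n \<Rightarrow> ereal) \<Rightarrow> real ^ 'n \<Rightarrow> real ^ 'n \<Rightarrow> real ^ 'n \<Rightarrow> bool" where
  "prox_step X \<eta> \<phi> g x x' \<longleftrightarrow>
    is_arg_min (\<lambda>z. ereal (1 / 2 * (norm (z - (x - \<eta> *\<^sub>R g)))\<^sup>2) + \<phi> (z - x)) (\<lambda>z. z \<in> X) x'"

definition minibatch ::
    "(real ^ 'n \<Rightarrow> 'z \<Rightarrow> real ^ 'n) \<Rightarrow> nat \<Rightarrow> real ^ 'n \<Rightarrow> (nat \<Rightarrow> 'z) \<Rightarrow> real ^ 'n" where
  "minibatch G m x zs = (1 / real m) *\<^sub>R (\<Sum>i=1..m. G x (zs i))"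

text \<open>
  The initial point, the samples and the output index take values in different types, so
  their mutual independence is stated for the sigma-algebras that they generate.
\<close>
datatype source = Initial | Sample nat nat | Output_Index

fun generated_events ::
    "'w measure \<Rightarrow> 'z measure \<Rightarrow> ('w \<Rightarrow> real ^ 'n) \<Rightarrow> (nat \<Rightarrow> nat \<Rightarrow> 'w \<Rightarrow> 'z) \<Rightarrow> ('w \<Rightarrow> nat) \<Rightarrow>
      source \<Rightarrow> 'w set set" where
  "generated_events M \<Xi> x1 zs Y Initial = sets (vimage_algebra (space M) x1 borel)"
| "generated_events M \<Xi> x1 zs Y (Sample k i) = sets (vimage_algebra (space M) (zs k i) \<Xi>)"
| "generated_events M \<Xi> x1 zs Y Output_Index = sets (vimage_algebra (space M) Y (count_space UNIV))"

end

theory Submission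
  imports Defs
begin

text \<open>
  The step \<open>x'\<close> minimizes over the intersection of \<open>X\<close> with an \<open>\<ell>\<^sub>1\<close>-ball of radius \<open>\<psi>\<close> centred in \<open>X\<close>, so
  the normal cones of the two sets add up: some \<open>a\<close> in the normal cone of the ball has
  \<open>\<psi> * infnorm a = a \<bullet> (x' - x)\<close>, and the negative of \<open>g + (x' - x) / \<eta> + a\<close> is normal to \<open>X\<close> at \<open>x'\<close>.
  Hence the subdifferential at \<open>x'\<close> has an element of size at most \<open>infnorm a\<close> plus \<open>(L + 1 / \<eta>) \<psi>\<close>
  plus the gradient error, while the descent inequality bounds \<open>\<psi> * infnorm a\<close> by the decrease of
  \<open>f\<close> plus \<open>L \<psi>\<^sup>2 / 2\<close> and \<open>\<psi>\<close> times the gradient error. Summation over the iterations telescopes.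

  The minibatch error is controlled by smoothing the maximum norm with a log-sum-exp of parameter
  \<open>\<beta>\<close>, which is \<open>\<beta>\<close>-smooth for the maximum norm by Hoeffding's lemma. Optimizing \<open>\<beta>\<close> gives
  \<open>sqrt (2 ln (2 d) \<sigma>\<^sup>2 / m)\<close>, and \<open>2 ln (2 d) \<le> e\<^sup>2 ln d\<close> for \<open>d \<ge> 2\<close>.
\<close>

section \<open>Proximal steps in an \<open>\<ell>\<^sub>1\<close>-ball\<close>

lemma infnorm_le_iff_cart: "infnorm (x :: real ^ 'n) \<le> c \<longleftrightarrow> (\<forall>i. \<bar>x $ i\<bar> \<le> c)"
proof
  show "\<forall>i. \<bar>x $ i\<bar> \<le> c" if "infnorm x \<le> c"
    using component_le_infnorm_cart[of x] that by (meson order_trans)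
  show "infnorm x \<le> c" if "\<forall>i. \<bar>x $ i\<bar> \<le> c"
    unfolding infnorm_cart using that by (intro cSup_least) auto
qed

lemma infnorm_attained_cart: "\<exists>i. infnorm (x :: real ^ 'n) = \<bar>x $ i\<bar>"
proof -
  have "\<exists>i. \<not> (\<bar>x $ i\<bar> < infnorm x)"
  proof (rule ccontr)
    assume "\<not> ?thesis"
    then have *: "\<And>i. \<bar>x $ i\<bar> < infnorm x" by auto
    have "infnorm x \<le> Max (range (\<lambda>i. \<bar>x $ i\<bar>))"
      by (subst infnorm_le_iff_cart) simp
    also have "\<dots> < infnorm x"
      using * by (subst Max_less_iff) auto
    finally show False by simp
  qed
  then show ?thesis
    using component_le_infnorm_cart[of x] by (metis order_le_less)
qed

lemma l1norm_nonneg [simp]: "0 \<le> l1norm x"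
  by (simp add: l1norm_def sum_nonneg)

lemma l1norm_zero [simp]: "l1norm 0 = 0"
  by (simp add: l1norm_def)

lemma l1norm_scaleR: "l1norm (c *\<^sub>R x) = \<bar>c\<bar> * l1norm x"
  by (simp add: l1norm_def abs_mult sum_distrib_left)

lemma l1norm_minus_commute: "l1norm (x - y) = l1norm (y - x)"
  by (simp add: l1norm_def abs_minus_commute)

lemma l1norm_triangle: "l1norm (x + y) \<le> l1norm x + l1norm y"
  unfolding l1norm_def by (simp flip: sum.distrib) (intro sum_mono abs_triangle_ineq)

lemma l1norm_axis [simp]: "l1norm (axis i c) = \<bar>c\<bar>"
  by (simp add: l1norm_def axis_def if_distrib cong: if_cong)

lemma norm_le_l1norm: "norm x \<le> l1norm x"
  unfolding l1norm_def by (rule norm_le_l1_cart)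

lemma infnorm_le_l1norm: "infnorm x \<le> l1norm x"
  using infnorm_le_norm norm_le_l1norm order_trans by blast

lemma continuous_on_l1norm [continuous_intros]:
  "continuous_on S g \<Longrightarrow> continuous_on S (\<lambda>x. l1norm (g x))"
  unfolding l1norm_def by (intro continuous_intros)

lemma inner_le_infnorm_l1norm: "\<bar>a \<bullet> b\<bar> \<le> infnorm a * l1norm b" for a b :: "real ^ 'n"
proof -
  have "\<bar>a \<bullet> b\<bar> \<le> (\<Sum>i\<in>UNIV. \<bar>a $ i\<bar> * \<bar>b $ i\<bar>)"
    unfolding inner_vec_def by (rule order_trans[OF sum_abs]) (simp add: abs_mult)
  also have "\<dots> \<le> (\<Sum>i\<in>UNIV. infnorm a * \<bar>b $ i\<bar>)"
    by (intro sum_mono mult_right_mono component_le_infnorm_cart) simp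
  finally show ?thesis
    by (simp add: l1norm_def sum_distrib_left)
qed

lemma convex_l1_ball: "convex {z. l1norm (z - x) \<le> r}" for x :: "real ^ 'n"
proof (rule convexI)
  fix y z :: "real ^ 'n" and u v :: real
  assume *: "y \<in> {z. l1norm (z - x) \<le> r}" "z \<in> {z. l1norm (z - x) \<le> r}"
    and uv: "0 \<le> u" "0 \<le> v" "u + v = 1"
  have "u *\<^sub>R y + v *\<^sub>R z - x = u *\<^sub>R (y - x) + v *\<^sub>R (z - x)"
    using uv by (simp add: algebra_simps flip: scaleR_add_left)
  then have "l1norm (u *\<^sub>R y + v *\<^sub>R z - x) \<le> u * l1norm (y - x) + v * l1norm (z - x)"
    using l1norm_triangle[of "u *\<^sub>R (y - x)" "v *\<^sub>R (z - x)"] uv by (simp add: l1norm_scaleR)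
  also have "\<dots> \<le> r"
    using convex_bound_le[of "l1norm (y - x)" r "l1norm (z - x)" u v] * uv by simp
  finally show "u *\<^sub>R y + v *\<^sub>R z \<in> {z. l1norm (z - x) \<le> r}" by simp
qed

lemma closed_l1_ball: "closed {z. l1norm (z - x) \<le> r}"
  by (intro closed_Collect_le continuous_intros)

text \<open>Along the segment from \<open>x\<close> to \<open>y\<close> the remainder
  \<open>g\<close> has nonpositive derivative: the change of the gradient is paired with
  \<open>y - x\<close> by duality of the maximum norm and the \<open>l1norm\<close>, and the
  Lipschitz bound gives at most \<open>L * t * n\<^sup>2\<close>.\<close>

lemma descent_l1:
  fixes f :: "real ^ 'n \<Rightarrow> real" and gradf :: "real ^ 'n \<Rightarrow> real ^ 'n"
  assumes "convex X" and grad: "\<And>y. y \<in> X \<Longrightarrow> GDERIV f y :> gradf y"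
    and lip: "\<And>y z. y \<in> X \<Longrightarrow> z \<in> X \<Longrightarrow> infnorm (gradf y - gradf z) \<le> L * l1norm (y - z)"
    and "x \<in> X" "y \<in> X"
  shows "f y \<le> f x + gradf x \<bullet> (y - x) + L / 2 * (l1norm (y - x))\<^sup>2"
proof -
  define n where "n = l1norm (y - x)"
  define p where "p t = x + t *\<^sub>R (y - x)" for t
  define g where "g t = f (p t) - t * (gradf x \<bullet> (y - x)) - L / 2 * t\<^sup>2 * n\<^sup>2" for t
  have pX: "p t \<in> X" if "0 \<le> t" "t \<le> 1" for t
  proof -
    have "p t = (1 - t) *\<^sub>R x + t *\<^sub>R y" by (simp add: p_def algebra_simps)
    then show ?thesis using \<open>convex X\<close> assms that unfolding convex_alt by auto
  qed
  have "g 1 \<le> g 0"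
  proof (rule DERIV_nonpos_imp_nonincreasing[where f = g])
    fix t :: real assume t: "0 \<le> t" "t \<le> 1"
    have f: "(f has_derivative (\<lambda>h. h \<bullet> gradf (p t))) (at (p t))"
      using grad[OF pX[OF t]] by (simp add: gderiv_def)
    have "(p has_derivative (\<lambda>s. s *\<^sub>R (y - x))) (at t)"
      unfolding p_def by (auto intro!: derivative_eq_intros)
    from has_derivative_compose[OF this f]
    have "((\<lambda>t. f (p t)) has_real_derivative ((y - x) \<bullet> gradf (p t))) (at t)"
      by (simp add: has_field_derivative_def mult.commute[of _ "_ \<bullet> _"])
    then have d: "(g has_real_derivative ((y - x) \<bullet> gradf (p t) - gradf x \<bullet> (y - x) - L * t * n\<^sup>2)) (at t)"
      unfolding g_def by (auto intro!: derivative_eq_intros)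
    have "(y - x) \<bullet> gradf (p t) - gradf x \<bullet> (y - x) = (gradf (p t) - gradf x) \<bullet> (y - x)"
      by (simp add: inner_commute inner_diff)
    also have "\<dots> \<le> infnorm (gradf (p t) - gradf x) * n"
      unfolding n_def using inner_le_infnorm_l1norm abs_le_D1 by blast
    also have "\<dots> \<le> L * l1norm (p t - x) * n"
      by (intro mult_right_mono lip pX t \<open>x \<in> X\<close>) (simp add: n_def)
    also have "\<dots> = L * t * n\<^sup>2"
      using t by (simp add: p_def l1norm_scaleR n_def power2_eq_square)
    finally show "\<exists>D. (g has_real_derivative D) (at t) \<and> D \<le> 0"
      using d by (intro exI[of _ "(y - x) \<bullet> gradf (p t) - gradf x \<bullet> (y - x) - L * t * n\<^sup>2"]) simp
  qed simp
  then show ?thesis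
    by (simp add: g_def p_def n_def)
qed

text \<open>Membership of \<open>x\<close> in \<open>X\<close> is not part of the condition, so 0
  always belongs to the cone and infima over its translates are never taken over the empty
  set.\<close>

definition normal_cone :: "'a::real_inner set \<Rightarrow> 'a \<Rightarrow> 'a set" where
  "normal_cone X x = {v. \<forall>y\<in>X. v \<bullet> (y - x) \<le> 0}"

text \<open>
  The multiplier \<open>a\<close> is the slope of a hyperplane separating the origin from the differences
  \<open>z - u\<close> with \<open>z \<in> X\<close> and \<open>u\<close> in the ball, lifted by the linear objective. The centre \<open>x \<in> X\<close> lies
  in the interior of the ball, so the hyperplane is not vertical.
\<close>
lemma l1_ball_multiplier:
  fixes X :: "(real ^ 'n) set"
  assumes "convex X" "x \<in> X" "p \<in> X" "l1norm (p - x) \<le> r" "r > 0"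
    and opt: "\<And>z. z \<in> X \<Longrightarrow> l1norm (z - x) \<le> r \<Longrightarrow> 0 \<le> g \<bullet> (z - p)"
  obtains a where "- (g + a) \<in> normal_cone X p" "r * infnorm a \<le> a \<bullet> (p - x)"
proof -
  define B where "B = {u. l1norm (u - x) \<le> r}"
  define S where "S = (\<lambda>((z, s), u). (z - u, g \<bullet> (z - p) + s)) ` ((X \<times> {0::real<..}) \<times> B)"
  have lin: "linear (\<lambda>((z, s), u). (z - u, g \<bullet> z + s :: real))"
    by (rule linearI) (auto simp: algebra_simps inner_add_right)
  have "S = (\<lambda>v. (0, - (g \<bullet> p)) + v) ` (\<lambda>((z, s), u). (z - u, g \<bullet> z + s)) ` ((X \<times> {0::real<..}) \<times> B)"
    unfolding S_def image_image by (intro image_cong) (auto simp: inner_diff_right)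
  then have "convex S"
    by (simp only:) (intro convex_translation convex_linear_image lin convex_Times \<open>convex X\<close>
      convex_real_interval, simp add: B_def convex_l1_ball)
  moreover have "0 \<notin> S"
    using opt by (fastforce simp: S_def B_def zero_prod_def)
  ultimately obtain ac where "ac \<noteq> 0" and ac: "\<And>v. v \<in> S \<Longrightarrow> 0 \<le> ac \<bullet> v"
    using separating_hyperplane_set_0[of S] by blast
  obtain a0 c where ac_eq: "ac = (a0, c)" by (cases ac)
  have sep: "0 \<le> a0 \<bullet> (z - u) + c * (g \<bullet> (z - p) + s)" if "z \<in> X" "u \<in> B" "s > 0" for z u s
  proof -
    have "(z - u, g \<bullet> (z - p) + s) \<in> S"
      using that unfolding S_def by (force intro!: image_eqI[of _ _ "((z, s), u)"])
    from ac[OF this] show ?thesis by (simp add: ac_eq)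
  qed
  have axB: "x + axis i t \<in> B" if "\<bar>t\<bar> \<le> r" for i t
    using that by (simp add: B_def)
  have "x \<in> B" "p \<in> B" using assms by (auto simp: B_def)
  have "c \<ge> 0"
  proof (rule ccontr)
    assume "\<not> c \<ge> 0"
    then have "c < 0" by simp
    \<comment> \<open>With \<open>z = u = x\<close> the \<open>a0\<close> term disappears, and this
      height makes the factor of \<open>c\<close> positive.\<close>
    define s where "s = 1 + \<bar>g \<bullet> (p - x)\<bar>"
    have "0 \<le> c * (g \<bullet> (x - p) + s)"
      using sep[of x x s] \<open>x \<in> X\<close> \<open>x \<in> B\<close> by (simp add: s_def)
    moreover have "g \<bullet> (x - p) + s > 0"
      by (simp add: s_def inner_diff_right)
    ultimately show False using \<open>c < 0\<close> by (simp add: zero_le_mult_iff)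
  qed
  moreover have "c \<noteq> 0"
  proof
    assume "c = 0"
    \<comment> \<open>For \<open>c = 0\<close> the objective drops out of the separation. Moving
      \<open>u\<close> from the centre by \<open>r\<close> in both directions of an axis, with
      \<open>z = x\<close>, kills that coordinate of \<open>a0\<close>.\<close>
    have "a0 $ i = 0" for i
    proof -
      have "0 \<le> - (r * (a0 $ i))" "0 \<le> r * (a0 $ i)"
        using sep[of x "x + axis i r" 1] sep[of x "x + axis i (- r)" 1] axB[of r i] axB[of "- r" i]
          \<open>c = 0\<close> \<open>x \<in> X\<close> \<open>r > 0\<close>
        by (simp_all add: inner_axis mult.commute)
      then have "r * (a0 $ i) = 0" by linarith
      then show ?thesis using \<open>r > 0\<close> by simp
    qed
    then have "a0 = 0" by (simp add: vec_eq_iff)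
    with \<open>ac \<noteq> 0\<close> \<open>c = 0\<close> show False by (simp add: ac_eq zero_prod_def)
  qed
  ultimately have "c > 0" by simp
  define a where "a = a0 /\<^sub>R c"
  \<comment> \<open>Division by \<open>c\<close>, then \<open>s\<close> tending to 0.\<close>
  have sep': "0 \<le> a \<bullet> (z - u) + g \<bullet> (z - p)" if "z \<in> X" "u \<in> B" for z u
  proof (rule field_le_epsilon)
    fix s :: real assume "s > 0"
    have "0 \<le> (a0 \<bullet> (z - u) + c * (g \<bullet> (z - p) + s)) / c"
      using sep[OF that \<open>s > 0\<close>] \<open>c > 0\<close> by simp
    also have "\<dots> = a \<bullet> (z - u) + g \<bullet> (z - p) + s"
      using \<open>c > 0\<close> by (simp add: a_def field_simps)
    finally show "0 \<le> a \<bullet> (z - u) + g \<bullet> (z - p) + s" .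
  qed
  show thesis
  proof
    show "- (g + a) \<in> normal_cone X p"
      unfolding normal_cone_def using sep'[OF _ \<open>p \<in> B\<close>]
      by (fastforce simp: inner_diff_left inner_minus_left)
    obtain i where i: "infnorm a = \<bar>a $ i\<bar>" using infnorm_attained_cart by blast
    \<comment> \<open>The sign matches the coordinate of \<open>a\<close> of largest modulus, so
      \<open>x + axis i t\<close> maximizes \<open>a\<close> over the ball.\<close>
    define t where "t = (if a $ i \<ge> 0 then r else - r)"
    have "0 \<le> a \<bullet> (p - (x + axis i t))"
      using sep'[OF \<open>p \<in> X\<close> axB[of t i]] \<open>r > 0\<close> by (simp add: t_def)
    also have "\<dots> = a \<bullet> (p - x) - r * infnorm a"
      by (simp add: i t_def inner_diff_right inner_add_right inner_axis mult.commute)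
    finally show "r * infnorm a \<le> a \<bullet> (p - x)" by simp
  qed
qed

text \<open>On the ball the indicator vanishes, so the step is a Euclidean projection onto a closed
  convex set. This gives the variational inequality at \<open>p\<close> and expresses the new
  iterate as a function of \<open>x\<close> and \<open>g\<close>, from which measurability is
  derived.\<close>

lemma prox_step_eq_closest_point:
  fixes X :: "(real ^ 'n) set"
  assumes "convex X" "closed X" "x \<in> X" "r > 0" and "prox_step X \<eta> (delta {z. l1norm z \<le> r}) g x p"
  shows "p = closest_point (X \<inter> {z. l1norm (z - x) \<le> r}) (x - \<eta> *\<^sub>R g)"
    and "p \<in> X" "l1norm (p - x) \<le> r"
proof -
  let ?h = "\<lambda>z. ereal (1 / 2 * (norm (z - (x - \<eta> *\<^sub>R g)))\<^sup>2) + delta {z. l1norm z \<le> r} (z - x)"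
  have "p \<in> X" and min: "\<And>z. z \<in> X \<Longrightarrow> ?h p \<le> ?h z"
    using assms(5) unfolding prox_step_def is_arg_min_linorder by auto
  show "p \<in> X" by fact
  \<comment> \<open>The objective is finite at the centre \<open>x\<close>, hence at the
    minimizer.\<close>
  show r: "l1norm (p - x) \<le> r"
    using min[OF \<open>x \<in> X\<close>] \<open>r > 0\<close> by (auto simp: delta_def split: if_splits)
  show "p = closest_point (X \<inter> {z. l1norm (z - x) \<le> r}) (x - \<eta> *\<^sub>R g)"
  proof (rule closest_point_unique)
    show "\<forall>z\<in>X \<inter> {z. l1norm (z - x) \<le> r}. dist (x - \<eta> *\<^sub>R g) p \<le> dist (x - \<eta> *\<^sub>R g) z"
    proof
      fix z assume "z \<in> X \<inter> {z. l1norm (z - x) \<le> r}"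
      with min[of z] r have "(norm (p - (x - \<eta> *\<^sub>R g)))\<^sup>2 \<le> (norm (z - (x - \<eta> *\<^sub>R g)))\<^sup>2"
        by (simp add: delta_def)
      then show "dist (x - \<eta> *\<^sub>R g) p \<le> dist (x - \<eta> *\<^sub>R g) z"
        by (subst (1 2) dist_commute, unfold dist_norm) (rule power2_le_imp_le, auto)
    qed
  qed (use assms \<open>p \<in> X\<close> r in \<open>auto intro!: convex_Int closed_Int convex_l1_ball closed_l1_ball\<close>)
qed

text \<open>The coefficient \<open>3 * L / 2\<close> is \<open>L\<close> for the drift of the
  gradient from \<open>x\<close> to \<open>p\<close> plus \<open>L / 2\<close> from the descent
  inequality; \<open>1 / \<eta>\<close> comes from the quadratic term of the step. The gradient
  error enters twice, once in the residual and once in the bound on the multiplier.\<close>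

lemma prox_step_stationarity:
  fixes f :: "real ^ 'n \<Rightarrow> real" and gradf :: "real ^ 'n \<Rightarrow> real ^ 'n"
  assumes X: "convex X" "closed X" "x \<in> X" and "r > 0" "\<eta> > 0"
    and grad: "\<And>y. y \<in> X \<Longrightarrow> GDERIV f y :> gradf y"
    and lip: "\<And>y z. y \<in> X \<Longrightarrow> z \<in> X \<Longrightarrow> infnorm (gradf y - gradf z) \<le> L * l1norm (y - z)"
    and "L \<ge> 0" and step: "prox_step X \<eta> (delta {z. l1norm z \<le> r}) g x p"
  obtains v where "v \<in> normal_cone X p"
    and "r * infnorm (gradf p + v) \<le>
      f x - f p + (3 * L / 2 + 1 / \<eta>) * r\<^sup>2 + 2 * (r * infnorm (g - gradf x))"
proof -
  note p = prox_step_eq_closest_point[OF X(1,2,3) \<open>r > 0\<close> step]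
  let ?C = "X \<inter> {z. l1norm (z - x) \<le> r}"
  \<comment> \<open>The gradient at \<open>p\<close> of the quadratic part of the step, divided by
    \<open>\<eta>\<close>.\<close>
  define h where "h = g + (p - x) /\<^sub>R \<eta>"
  define \<delta> where "\<delta> = g - gradf x"
  have opt: "0 \<le> h \<bullet> (z - p)" if "z \<in> X" "l1norm (z - x) \<le> r" for z
  proof -
    have "(x - \<eta> *\<^sub>R g - p) \<bullet> (z - p) \<le> 0"
      using closest_point_dot[of ?C z "x - \<eta> *\<^sub>R g"] that X p(1)
      by (simp add: convex_Int closed_Int convex_l1_ball closed_l1_ball)
    also have "x - \<eta> *\<^sub>R g - p = - \<eta> *\<^sub>R h"
      using \<open>\<eta> > 0\<close> by (simp add: h_def algebra_simps)
    finally show ?thesis using \<open>\<eta> > 0\<close> by (simp add: zero_le_mult_iff)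
  qed
  obtain a where a: "- (h + a) \<in> normal_cone X p" "r * infnorm a \<le> a \<bullet> (p - x)"
    using l1_ball_multiplier[OF X(1,3) p(2,3) \<open>r > 0\<close> opt] by blast
  have "infnorm (gradf p + - (h + a)) =
      infnorm ((gradf p - gradf x) + (- \<delta> + (- ((p - x) /\<^sub>R \<eta>) + - a)))"
    by (simp add: h_def \<delta>_def algebra_simps)
  also have "\<dots> \<le> infnorm (gradf p - gradf x) + (infnorm \<delta> + (infnorm ((p - x) /\<^sub>R \<eta>) + infnorm a))"
    using infnorm_triangle[of "gradf p - gradf x" "- \<delta> + (- ((p - x) /\<^sub>R \<eta>) + - a)"]
      infnorm_triangle[of "- \<delta>" "- ((p - x) /\<^sub>R \<eta>) + - a"]
      infnorm_triangle[of "- ((p - x) /\<^sub>R \<eta>)" "- a"] by (simp only: infnorm_neg)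
  also have "infnorm (gradf p - gradf x) \<le> L * r"
    using lip[OF p(2) X(3)] mult_left_mono[OF p(3) \<open>L \<ge> 0\<close>] by linarith
  also have "infnorm ((p - x) /\<^sub>R \<eta>) \<le> r / \<eta>"
    using \<open>\<eta> > 0\<close> order_trans[OF infnorm_le_l1norm p(3)]
    by (simp add: infnorm_mul divide_inverse mult.commute mult_left_mono)
  finally have 1: "infnorm (gradf p + - (h + a)) \<le> L * r + (infnorm \<delta> + (r / \<eta> + infnorm a))"
    by simp
  \<comment> \<open>Testing the normal vector at the centre \<open>x\<close> bounds the multiplier
    term by the linearized decrease.\<close>
  have "- (h + a) \<bullet> (x - p) \<le> 0"
    using a(1) X(3) unfolding normal_cone_def by blast
  then have 0: "a \<bullet> (p - x) \<le> h \<bullet> (x - p)"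
    by (simp add: inner_diff_left inner_diff_right)
  have "r * infnorm a \<le> a \<bullet> (p - x)" by fact
  also have "\<dots> \<le> h \<bullet> (x - p)"
    by (rule 0)
  also have "\<dots> = gradf x \<bullet> (x - p) + \<delta> \<bullet> (x - p) - (norm (p - x))\<^sup>2 / \<eta>"
    by (simp add: h_def \<delta>_def inner_diff_left inner_diff_right inner_add_left
        power2_norm_eq_inner divide_inverse algebra_simps)
  also have "\<dots> \<le> gradf x \<bullet> (x - p) + \<delta> \<bullet> (x - p)"
    using \<open>\<eta> > 0\<close> by simp
  also have "gradf x \<bullet> (x - p) \<le> f x - f p + L / 2 * r\<^sup>2"
  proof -
    have "L / 2 * (l1norm (p - x))\<^sup>2 \<le> L / 2 * r\<^sup>2"
      using p(3) \<open>L \<ge> 0\<close> by (intro mult_left_mono power_mono) auto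
    with descent_l1[OF X(1) grad lip X(3) p(2)] show ?thesis
      by (simp add: inner_diff_right)
  qed
  also have "\<delta> \<bullet> (x - p) \<le> infnorm \<delta> * r"
  proof -
    have "\<delta> \<bullet> (x - p) \<le> infnorm \<delta> * l1norm (x - p)"
      using inner_le_infnorm_l1norm abs_le_D1 by blast
    also have "\<dots> \<le> infnorm \<delta> * r"
      using p(3) by (intro mult_left_mono) (auto simp: l1norm_minus_commute infnorm_pos_le)
    finally show ?thesis .
  qed
  finally have 2: "r * infnorm a \<le> f x - f p + L / 2 * r\<^sup>2 + infnorm \<delta> * r" by simp
  show thesis
  proof
    show "- (h + a) \<in> normal_cone X p" by fact
    have "r * infnorm (gradf p + - (h + a)) \<le> r * (L * r + (infnorm \<delta> + (r / \<eta> + infnorm a)))"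
      using 1 \<open>r > 0\<close> by (intro mult_left_mono) auto
    also have "\<dots> \<le> f x - f p + (3 * L / 2 + 1 / \<eta>) * r\<^sup>2 + 2 * (r * infnorm \<delta>)"
      using 2 by (simp add: algebra_simps power2_eq_square)
    finally show "r * infnorm (gradf p + - (h + a)) \<le>
      f x - f p + (3 * L / 2 + 1 / \<eta>) * r\<^sup>2 + 2 * (r * infnorm (g - gradf x))"
      unfolding \<delta>_def .
  qed
qed

text \<open>Equivalence of norms in finite dimension turns the mixed Lipschitz bound into Euclidean
  continuity, which the measurability arguments use.\<close>

lemma continuous_on_l1_infnorm_lipschitz:
  fixes g :: "real ^ 'n \<Rightarrow> real ^ 'n"
  assumes lip: "\<And>y z. y \<in> X \<Longrightarrow> z \<in> X \<Longrightarrow> infnorm (g y - g z) \<le> L * l1norm (y - z)"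
  shows "continuous_on X g"
  unfolding continuous_on_def
proof
  fix x assume "x \<in> X"
  let ?b = "\<lambda>y. sqrt DIM(real ^ 'n) * (L * l1norm (y - x))"
  have "continuous_on X ?b" by (intro continuous_intros)
  then have "(?b \<longlongrightarrow> ?b x) (at x within X)"
    using \<open>x \<in> X\<close> unfolding continuous_on_def by blast
  then have "(?b \<longlongrightarrow> 0) (at x within X)"
    by (simp only: diff_self l1norm_zero mult_zero_right)
  moreover have "\<forall>\<^sub>F y in at x within X. norm (g y - g x) \<le> ?b y"
    unfolding eventually_at_filter
  proof (intro always_eventually allI impI)
    fix y assume "y \<in> X"
    have "norm (g y - g x) \<le> sqrt DIM(real ^ 'n) * infnorm (g y - g x)"
      by (rule norm_le_infnorm)
    also have "\<dots> \<le> ?b y" by (intro mult_left_mono lip \<open>x \<in> X\<close> \<open>y \<in> X\<close>) simp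
    finally show "norm (g y - g x) \<le> ?b y" .
  qed
  ultimately have "((\<lambda>y. g y - g x) \<longlongrightarrow> 0) (at x within X)"
    by (rule Lim_null_comparison[rotated])
  then show "(g \<longlongrightarrow> g x) (at x within X)" by (simp add: Lim_null[of g])
qed

section \<open>Subdifferentials and measurability\<close>

text \<open>Differentiability makes the remainder of \<open>f\<close> negligible against
  \<open>norm (y - x)\<close>. A direction violating the normal cone inequality can be shrunk
  towards \<open>x\<close> inside the convex set, where the violation stays proportional to the
  distance. Conversely, points outside \<open>X\<close> contribute infinite quotients.\<close>

lemma frechet_subdiff_add_delta:
  fixes X :: "'a::euclidean_space set"
  assumes "convex X" "x \<in> X" "GDERIV f x :> g"
  shows "frechet_subdiff (\<lambda>y. ereal (f y) + delta X y) x = (+) g ` normal_cone X x"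
proof -
  define h where "h y = ereal (f y) + delta X y" for y
  define q where "q w y = (h y - h x - ereal (w \<bullet> (y - x))) / ereal (norm (y - x))" for w y
  have hx: "h x = ereal (f x)" using \<open>x \<in> X\<close> by (simp add: h_def delta_def)
  have q_in: "q w y = ereal ((f y - f x - w \<bullet> (y - x)) / norm (y - x))" if "y \<in> X" "y \<noteq> x" for w y
    using that by (simp add: q_def hx) (simp add: h_def delta_def)
  have q_out: "q w y = \<infinity>" if "y \<notin> X" for w y
  proof -
    have "y \<noteq> x" using that \<open>x \<in> X\<close> by auto
    then show ?thesis using that by (simp add: q_def hx) (simp add: h_def delta_def)
  qed
  have deriv: "\<forall>\<^sub>F y in at x. \<bar>f y - f x - g \<bullet> (y - x)\<bar> < e * norm (y - x)" if "e > 0" for e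
  proof -
    have "((\<lambda>y. norm (f y - f x - (y - x) \<bullet> g) / norm (y - x)) \<longlongrightarrow> 0) (at x)"
      using assms(3) unfolding gderiv_def has_derivative_iff_norm by simp
    from order_tendstoD(2)[OF this \<open>e > 0\<close>] show ?thesis
      unfolding eventually_at_filter
      by (rule eventually_mono) (auto simp: divide_less_eq inner_commute[of g])
  qed
  have "w \<in> frechet_subdiff h x \<longleftrightarrow> w - g \<in> normal_cone X x" for w
  proof
    assume "w \<in> frechet_subdiff h x"
    then have ev: "\<forall>\<^sub>F y in at x. c < q w y" if "c < 0" for c
      using that unfolding frechet_subdiff_def le_Liminf_iff q_def by auto
    show "w - g \<in> normal_cone X x"
      unfolding normal_cone_def
    proof safe
      fix y assume "y \<in> X"
      show "(w - g) \<bullet> (y - x) \<le> 0"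
      proof (rule ccontr)
        assume "\<not> ?thesis"
        then have c: "(w - g) \<bullet> (y - x) > 0" by simp
        then have "y \<noteq> x" by auto
        define n where "n = norm (y - x)"
        have "n > 0" using \<open>y \<noteq> x\<close> by (simp add: n_def)
        \<comment> \<open>Half the slope of the violation: the subgradient inequality and the
          derivative estimate each lose \<open>e\<close>.\<close>
        define e where "e = (w - g) \<bullet> (y - x) / (2 * n)"
        have "e > 0" using c \<open>n > 0\<close> by (simp add: e_def)
        define z where "z t = x + t *\<^sub>R (y - x)" for t :: real
        have "(z \<longlongrightarrow> z 0) (at_right 0)" unfolding z_def by (intro tendsto_intros)
        then have z: "filterlim z (at x) (at_right 0)"
          by (auto simp: filterlim_at z_def \<open>y \<noteq> x\<close> eventually_at_filter)
        have "\<forall>\<^sub>F t in at_right 0. ereal (- e) < q w (z t) \<and>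
            \<bar>f (z t) - f x - g \<bullet> (z t - x)\<bar> < e * norm (z t - x)"
          using ev[of "ereal (- e)"] deriv[OF \<open>e > 0\<close>] \<open>e > 0\<close> z
          by (intro eventually_conj; elim eventually_compose_filterlim[rotated]) auto
        moreover have "\<forall>\<^sub>F t in at_right 0. t \<in> {0<..<1::real}"
          by (rule eventually_at_right_real) simp
        ultimately have "\<forall>\<^sub>F t in at_right 0. (ereal (- e) < q w (z t) \<and>
            \<bar>f (z t) - f x - g \<bullet> (z t - x)\<bar> < e * norm (z t - x)) \<and> t \<in> {0<..<1::real}"
          by (rule eventually_conj)
        then obtain t where t: "ereal (- e) < q w (z t)" "0 < t" "t < 1"
            "\<bar>f (z t) - f x - g \<bullet> (z t - x)\<bar> < e * norm (z t - x)"
          using eventually_happens[of _ "at_right (0::real)"] by auto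
        have "z t = (1 - t) *\<^sub>R x + t *\<^sub>R y" by (simp add: z_def algebra_simps)
        then have zX: "z t \<in> X"
          using \<open>convex X\<close> \<open>x \<in> X\<close> \<open>y \<in> X\<close> t unfolding convex_alt by auto
        have zt: "z t - x = t *\<^sub>R (y - x)" by (simp add: z_def)
        have nz: "norm (z t - x) = t * n" using t by (simp add: zt n_def)
        have "z t \<noteq> x" using t \<open>y \<noteq> x\<close> by (simp add: z_def)
        with t(1) have "- e < (f (z t) - f x - w \<bullet> (z t - x)) / norm (z t - x)"
          by (simp add: q_in[OF zX])
        then have "- e * (t * n) < f (z t) - f x - w \<bullet> (z t - x)"
          using t \<open>n > 0\<close> by (simp add: nz pos_less_divide_eq)
        with t(4) have "(w - g) \<bullet> (z t - x) < 2 * (e * (t * n))"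
          by (simp add: nz inner_diff_left)
        also have "\<dots> = t * ((w - g) \<bullet> (y - x))"
          using \<open>n > 0\<close> by (simp add: e_def)
        finally show False by (simp add: zt)
      qed
    qed
  next
    assume N: "w - g \<in> normal_cone X x"
    have "\<forall>\<^sub>F y in at x. c < q w y" if "c < 0" for c
    proof -
      \<comment> \<open>The gap between \<open>c\<close> and 0 supplies the tolerance for the
        derivative on \<open>X\<close>.\<close>
      obtain e where e: "c < ereal (- e)" "e > 0"
      proof -
        from \<open>c < 0\<close> obtain r where "c < ereal r" "ereal r < 0"
          using ereal_dense2[of c 0] by auto
        then show thesis using that[of "- r"] by auto
      qed
      have "\<forall>\<^sub>F y in at x. y \<noteq> x" by (simp add: eventually_at_filter)
      with deriv[OF e(2)] show ?thesis
      proof eventually_elim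
        fix y assume y: "\<bar>f y - f x - g \<bullet> (y - x)\<bar> < e * norm (y - x)" "y \<noteq> x"
        show "c < q w y"
        proof (cases "y \<in> X")
          case True
          have "(w - g) \<bullet> (y - x) \<le> 0" using N True unfolding normal_cone_def by blast
          with y have "- e * norm (y - x) \<le> f y - f x - w \<bullet> (y - x)"
            by (simp add: inner_diff_left)
          with y have "- e \<le> (f y - f x - w \<bullet> (y - x)) / norm (y - x)"
            by (simp add: pos_le_divide_eq)
          with e show ?thesis using y by (simp add: q_in[OF True]) (meson ereal_less_eq(3) less_le_trans)
        next
          case False
          with \<open>c < 0\<close> show ?thesis by (auto simp: q_out)
        qed
      qed
    qed
    then show "w \<in> frechet_subdiff h x"
      unfolding frechet_subdiff_def le_Liminf_iff q_def by (simp add: hx)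
  qed
  then have "frechet_subdiff h x = (+) g ` normal_cone X x"
    by (force simp: image_iff intro!: bexI[of _ "_ - g"])
  then show ?thesis by (simp add: h_def[abs_def])
qed

lemma zero_in_normal_cone: "0 \<in> normal_cone X x"
  by (simp add: normal_cone_def)

lemma infdist0_nonneg: "S \<noteq> {} \<Longrightarrow> 0 \<le> infdist0 S"
  unfolding infdist0_def by (intro cINF_greatest) (auto simp: infnorm_pos_le)

lemma infdist0_le: "v \<in> S \<Longrightarrow> infdist0 S \<le> infnorm v"
  unfolding infdist0_def by (intro cINF_lower bdd_belowI2[of _ 0]) (auto simp: infnorm_pos_le)

lemma infdist0_less_iff: "S \<noteq> {} \<Longrightarrow> infdist0 S < c \<longleftrightarrow> (\<exists>v\<in>S. infnorm v < c)"
  unfolding infdist0_def by (intro cINF_less_iff bdd_belowI2[of _ 0]) (auto simp: infnorm_pos_le)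

lemma compact_infnorm_ball: "compact {w :: 'a::euclidean_space. infnorm w \<le> c}"
  unfolding compact_eq_bounded_closed
proof
  show "bounded {w :: 'a. infnorm w \<le> c}"
  proof (rule boundedI)
    fix w :: 'a assume "w \<in> {w. infnorm w \<le> c}"
    then show "norm w \<le> sqrt DIM('a) * c"
      by (intro order_trans[OF norm_le_infnorm] mult_left_mono) auto
  qed
  show "closed {w :: 'a. infnorm w \<le> c}"
    by (intro closed_Collect_le continuous_intros)
qed

text \<open>
  The distance is only lower semicontinuous in general: its sublevel sets are projections of
  the closed graph of the subdifferential along a compact ball.
\<close>
lemma borel_measurable_infdist0_normal_cone:
  fixes X :: "'a::euclidean_space set"
  assumes "closed X" and cont: "continuous_on X g"
  shows "(\<lambda>x. infdist0 ((+) (g x) ` normal_cone X x)) \<in> borel_measurable (restrict_space borel X)"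
  unfolding borel_measurable_iff_less
proof
  fix c :: real
  \<comment> \<open>Pairs of a subgradient and its base point. \<open>C r\<close> collects the base
    points that have a subgradient in the ball of radius \<open>r\<close>.\<close>
  define T where "T = {p \<in> UNIV \<times> X. \<forall>y\<in>X. (fst p - g (snd p)) \<bullet> (y - snd p) \<le> 0}"
  define C where "C r = {x. \<exists>w. w \<in> {w. infnorm w \<le> r} \<and> (w, x) \<in> T}" for r
  have cg: "continuous_on (UNIV \<times> X) (\<lambda>p :: 'a \<times> 'a. g (snd p))"
    by (rule continuous_on_compose2[OF cont]) (auto intro!: continuous_intros)
  have "T = (UNIV \<times> X) \<inter> (\<Inter>y\<in>X. {p \<in> UNIV \<times> X. (fst p - g (snd p)) \<bullet> (y - snd p) \<le> 0})"
    by (auto simp: T_def)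
  moreover have "closed \<dots>"
    using \<open>closed X\<close>
    by (intro closed_Int closed_INT ballI closed_Times continuous_on_closed_Collect_le
        continuous_intros cg) auto
  ultimately have "closed T" by simp
  then have C: "closed (C r)" for r
    unfolding C_def by (intro closed_compact_projection compact_infnorm_ball)
  \<comment> \<open>A strict inequality leaves a gap of size \<open>1 / Suc n\<close>, so the open
    sublevel set is a countable union of closed sets.\<close>
  have "{x \<in> space (restrict_space borel X). infdist0 ((+) (g x) ` normal_cone X x) < c} =
    (\<Union>n. C (c - 1 / real (Suc n)))" (is "?A = ?B")
  proof (intro equalityI subsetI)
    fix x assume "x \<in> ?A"
    then have x: "x \<in> X" and "infdist0 ((+) (g x) ` normal_cone X x) < c"
      by (auto simp: space_restrict_space)
    then obtain v where v: "v \<in> normal_cone X x" "infnorm (g x + v) < c"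
      using zero_in_normal_cone[of X x] by (subst (asm) infdist0_less_iff) auto
    then obtain n where "inverse (real (Suc n)) < c - infnorm (g x + v)"
      using reals_Archimedean[of "c - infnorm (g x + v)"] by auto
    then have "infnorm (g x + v) \<le> c - 1 / real (Suc n)"
      by (simp add: divide_inverse)
    with v x have "x \<in> C (c - 1 / real (Suc n))"
      unfolding C_def T_def normal_cone_def by (auto intro!: exI[of _ "g x + v"])
    then show "x \<in> ?B" by blast
  next
    fix x assume "x \<in> ?B"
    then obtain n w where w: "infnorm w \<le> c - 1 / real (Suc n)" "(w, x) \<in> T"
      by (auto simp: C_def)
    then have "w - g x \<in> normal_cone X x" "x \<in> X"
      by (auto simp: T_def normal_cone_def)
    moreover have "infnorm w < c"
      by (rule le_less_trans[OF w(1)]) simp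
    ultimately have "\<exists>v\<in>(+) (g x) ` normal_cone X x. infnorm v < c"
      by (force intro!: bexI[of _ w] image_eqI[of _ _ "w - g x"])
    then show "x \<in> ?A"
      using \<open>x \<in> X\<close> by (subst (asm) infdist0_less_iff[symmetric])
        (use zero_in_normal_cone[of X x] in \<open>auto simp: space_restrict_space\<close>)
  qed
  moreover have "?B \<in> sets borel" using C by (intro sets.countable_UN) auto
  moreover have "?B \<subseteq> X" by (auto simp: C_def T_def)
  ultimately show "{x \<in> space (restrict_space borel X). infdist0 ((+) (g x) ` normal_cone X x) < c}
      \<in> sets (restrict_space borel X)"
    using \<open>closed X\<close> by (subst sets_restrict_space_iff) auto
qed

text \<open>
  The feasible sets move with their centre. Shrinking each projection towards the other centre
  by the factor \<open>r / (r + e)\<close> makes it feasible for the other problem.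
\<close>
lemma closest_point_l1_ball_perturbation:
  fixes X :: "(real ^ 'n) set" and u u' :: "real ^ 'n"
  assumes "convex X" "closed X" "x \<in> X" "x' \<in> X" "r > 0"
  defines "P \<equiv> closest_point (X \<inter> {z. l1norm (z - x) \<le> r}) u"
    and "P' \<equiv> closest_point (X \<inter> {z. l1norm (z - x') \<le> r}) u'"
    and "e \<equiv> l1norm (x' - x)"
  shows "(norm (P' - P))\<^sup>2 \<le> norm (u' - u) * (2 * r + e) + e * (norm (u - x) + norm (u' - x') + 2 * r)"
proof -
  have half: "norm (v - Q) \<le> norm (v - y) + r" "norm (Q - y) \<le> r"
    "(v - Q) \<bullet> (Q' - Q) \<le> l1norm (y' - y) * (norm (v - y) + r)"
    if "y \<in> X" "y' \<in> X" "Q = closest_point (X \<inter> {z. l1norm (z - y) \<le> r}) v"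
      "Q' = closest_point (X \<inter> {z. l1norm (z - y') \<le> r}) v'" for y y' v v' Q Q'
  proof -
    let ?C = "\<lambda>y. X \<inter> {z. l1norm (z - y) \<le> r}"
    have cc: "convex (?C y)" "closed (?C y)" for y
      using assms by (auto intro!: convex_Int closed_Int convex_l1_ball closed_l1_ball)
    have ne: "y \<in> ?C y" if "y \<in> X" for y using that \<open>r > 0\<close> by simp
    have Q: "Q \<in> ?C y" "Q' \<in> ?C y'"
      using closest_point_in_set[OF cc(2)] ne that by blast+
    show n1: "norm (Q - y) \<le> r" using Q norm_le_l1norm[of "Q - y"] by simp
    show n2: "norm (v - Q) \<le> norm (v - y) + r"
      using n1 norm_triangle_ineq[of "v - y" "y - Q"] by (simp add: norm_minus_commute)
    define d where "d = l1norm (y' - y)"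
    have "d \<ge> 0" by (simp add: d_def)
    \<comment> \<open>The distance of \<open>Q'\<close> from the centre \<open>y\<close> is at most
      \<open>r + d\<close>, and \<open>1 - t\<close> scales this down to exactly
      \<open>r\<close>.\<close>
    define t where "t = d / (r + d)"
    have t: "0 \<le> t" "t \<le> 1" "t * (r + d) = d" "(1 - t) * (r + d) = r"
      using \<open>r > 0\<close> \<open>d \<ge> 0\<close> by (auto simp: t_def field_simps)
    have d1: "l1norm (Q' - y) \<le> r + d"
      using l1norm_triangle[of "Q' - y'" "y' - y"] Q by (simp add: d_def)
    define z where "z = (1 - t) *\<^sub>R Q' + t *\<^sub>R y"
    have "z - y = (1 - t) *\<^sub>R (Q' - y)" by (simp add: z_def algebra_simps)
    then have "l1norm (z - y) = (1 - t) * l1norm (Q' - y)"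
      using t by (simp add: l1norm_scaleR)
    also have "\<dots> \<le> (1 - t) * (r + d)"
      using t d1 by (intro mult_left_mono) auto
    finally have "l1norm (z - y) \<le> (1 - t) * (r + d)" .
    moreover have "z \<in> X"
      using \<open>convex X\<close> Q \<open>y \<in> X\<close> t unfolding convex_alt z_def by auto
    ultimately have "z \<in> ?C y" using t by simp
    then have "(v - Q) \<bullet> (z - Q) \<le> 0"
      using closest_point_dot[OF cc, of z y v] that by simp
    moreover have "z - Q = (Q' - Q) + t *\<^sub>R (y - Q')" by (simp add: z_def algebra_simps)
    ultimately have "(v - Q) \<bullet> (Q' - Q) \<le> t * ((v - Q) \<bullet> (Q' - y))"
      by (simp add: inner_add_right inner_diff_right algebra_simps)
    also have "\<dots> \<le> t * (norm (v - Q) * (r + d))"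
      using t order_trans[OF norm_le_l1norm d1]
      by (intro mult_left_mono order_trans[OF norm_cauchy_schwarz]) auto
    also have "\<dots> = d * norm (v - Q)" using t(3) by (simp add: mult_ac)
    also have "\<dots> \<le> d * (norm (v - y) + r)" using n2 \<open>d \<ge> 0\<close> by (intro mult_left_mono)
    finally show "(v - Q) \<bullet> (Q' - Q) \<le> l1norm (y' - y) * (norm (v - y) + r)"
      by (simp add: d_def)
  qed
  note A = half[OF \<open>x \<in> X\<close> \<open>x' \<in> X\<close> P_def[THEN meta_eq_to_obj_eq] P'_def[THEN meta_eq_to_obj_eq]]
  note B = half[OF \<open>x' \<in> X\<close> \<open>x \<in> X\<close> P'_def[THEN meta_eq_to_obj_eq] P_def[THEN meta_eq_to_obj_eq]]
  have "norm (P' - P) = norm ((P' - x') + ((x' - x) + (x - P)))" by simp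
  also have "\<dots> \<le> norm (P' - x') + (norm (x' - x) + norm (x - P))"
    by (meson norm_triangle_ineq add_left_mono order_trans)
  also have "\<dots> \<le> r + (e + r)"
    using A(2) B(2) norm_le_l1norm[of "x' - x"] unfolding e_def
    by (intro add_mono) (simp_all add: norm_minus_commute)
  finally have n: "norm (P' - P) \<le> 2 * r + e" by simp
  \<comment> \<open>The two variational inequalities are added; what remains is the displacement of
    the projected points.\<close>
  have "(norm (P' - P))\<^sup>2 = (u' - u) \<bullet> (P' - P) + ((u - P) \<bullet> (P' - P) + (u' - P') \<bullet> (P - P'))"
    by (simp add: power2_norm_eq_inner inner_diff_left inner_diff_right inner_commute)
  also have "(u' - u) \<bullet> (P' - P) \<le> norm (u' - u) * (2 * r + e)"
    using n by (intro order_trans[OF norm_cauchy_schwarz] mult_left_mono) auto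
  also have "(u - P) \<bullet> (P' - P) + (u' - P') \<bullet> (P - P') \<le>
      e * (norm (u - x) + r) + e * (norm (u' - x') + r)"
    using A(3) B(3) by (intro add_mono) (simp_all add: e_def l1norm_minus_commute)
  finally show ?thesis by (simp add: algebra_simps)
qed

text \<open>The perturbation bound tends to 0 as centre and argument converge together. Joint
  continuity is the form required, since both are random in the iteration.\<close>

lemma continuous_on_closest_point_l1_ball:
  fixes X :: "(real ^ 'n) set"
  assumes "convex X" "closed X" "r > 0"
  shows "continuous_on (X \<times> UNIV) (\<lambda>(x, u). closest_point (X \<inter> {z. l1norm (z - x) \<le> r}) u)"
  unfolding continuous_on_def
proof
  fix p :: "(real ^ 'n) \<times> (real ^ 'n)" assume "p \<in> X \<times> UNIV"
  then obtain x u where p: "p = (x, u)" and "x \<in> X" by blast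
  let ?P = "\<lambda>(x, u). closest_point (X \<inter> {z. l1norm (z - x) \<le> r}) u"
  let ?b = "\<lambda>(x', u'). sqrt (norm (u' - u) * (2 * r + l1norm (x' - x)) +
    l1norm (x' - x) * (norm (u - x) + norm (u' - x') + 2 * r))"
  have "continuous_on (X \<times> UNIV) ?b"
    unfolding case_prod_beta by (intro continuous_intros)
  then have "(?b \<longlongrightarrow> ?b (x, u)) (at (x, u) within X \<times> UNIV)"
    using \<open>x \<in> X\<close> unfolding continuous_on_def by blast
  then have "(?b \<longlongrightarrow> 0) (at (x, u) within X \<times> UNIV)"
    by simp
  moreover have "\<forall>\<^sub>F p in at (x, u) within X \<times> UNIV. norm (?P p - ?P (x, u)) \<le> ?b p"
    unfolding eventually_at_filter
    using closest_point_l1_ball_perturbation[OF assms(1,2) \<open>x \<in> X\<close> _ \<open>r > 0\<close>, of _ _ u]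
    by (intro always_eventually) (auto intro!: real_le_rsqrt)
  ultimately have "((\<lambda>p. ?P p - ?P (x, u)) \<longlongrightarrow> 0) (at (x, u) within X \<times> UNIV)"
    by (rule Lim_null_comparison[rotated])
  then show "(?P \<longlongrightarrow> ?P p) (at p within X \<times> UNIV)"
    unfolding p by (subst Lim_null)
qed

section \<open>A maximal inequality for sums of independent vectors\<close>

text \<open>Hoeffding's lemma for the probability weights \<open>p\<close>: the values lie in an
  interval of length \<open>2 * c\<close>, and
  \<open>(2 * c)\<^sup>2 / 8 = c\<^sup>2 / 2\<close>.\<close>

lemma sum_exp_le_Hoeffding:
  fixes p a :: "'i::finite \<Rightarrow> real"
  assumes p: "\<And>i. p i \<ge> 0" "(\<Sum>i\<in>UNIV. p i) = 1" and a: "\<And>i. \<bar>a i\<bar> \<le> c"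
  shows "(\<Sum>i\<in>UNIV. p i * exp (a i)) \<le> exp ((\<Sum>i\<in>UNIV. p i * a i) + c\<^sup>2 / 2)"
proof -
  let ?M = "point_measure (UNIV :: 'i set) p"
  have "emeasure ?M UNIV = 1"
    using p by (simp add: emeasure_point_measure_finite sum_ennreal)
  then interpret prob_space ?M
    by (intro prob_spaceI) (simp add: space_point_measure)
  interpret interval_bounded_random_variable ?M a "- c" c
    using a by unfold_locales (auto simp: abs_le_iff minus_le_iff measurable_def space_point_measure sets_point_measure)
  define \<mu> where "\<mu> = (\<Sum>i\<in>UNIV. p i * a i)"
  have \<mu>: "expectation a = \<mu>"
    unfolding \<mu>_def using p by (subst lebesgue_integral_point_measure_finite) auto
  have "ennreal (\<Sum>i\<in>UNIV. p i * exp (a i - \<mu>)) = (\<integral>\<^sup>+ i. exp (1 * (a i - \<mu>)) \<partial>?M)"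
    using p by (subst nn_integral_point_measure_finite) (auto simp: ennreal_mult simp flip: sum_ennreal)
  also have "\<dots> \<le> ennreal (exp (1\<^sup>2 * (c - (- c))\<^sup>2 / 8))"
    using Hoeffdings_lemma_nn_integral[of 1] \<mu> by simp
  finally have "(\<Sum>i\<in>UNIV. p i * exp (a i - \<mu>)) \<le> exp (c\<^sup>2 / 2)"
    by (simp add: power2_eq_square)
  then have "(\<Sum>i\<in>UNIV. p i * exp (a i - \<mu>)) * exp \<mu> \<le> exp (c\<^sup>2 / 2) * exp \<mu>"
    by (intro mult_right_mono) auto
  then show ?thesis
    by (simp add: sum_distrib_right mult.assoc flip: exp_add \<mu>_def) (simp add: add.commute)
qed

text \<open>Attaching a sign to each coordinate writes the maximum norm as a maximum of linear
  functionals, twice as many as the dimension. This is the origin of the factor 2 inside the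
  logarithm.\<close>

definition signed_coord :: "'n \<times> bool \<Rightarrow> real ^ 'n \<Rightarrow> real" where
  "signed_coord i v = (if snd i then v $ fst i else - (v $ fst i))"

lemma abs_signed_coord_le: "\<bar>signed_coord i v\<bar> \<le> infnorm v"
  using component_le_infnorm_cart[of v "fst i"] by (simp add: signed_coord_def)

lemma signed_coord_add: "signed_coord i (v + w) = signed_coord i v + signed_coord i w"
  by (simp add: signed_coord_def)

lemma signed_coord_0 [simp]: "signed_coord i 0 = 0"
  by (simp add: signed_coord_def)

lemma infnorm_eq_signed_coord: "\<exists>i. infnorm v = signed_coord i v"
proof -
  obtain j where "infnorm v = \<bar>v $ j\<bar>" using infnorm_attained_cart by blast
  then have "infnorm v = signed_coord (j, v $ j \<ge> 0) v" by (simp add: signed_coord_def)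
  then show ?thesis by blast
qed

lemma continuous_on_signed_coord [continuous_intros]:
  "continuous_on S g \<Longrightarrow> continuous_on S (\<lambda>x. signed_coord i (g x))"
  by (cases "snd i") (auto simp: signed_coord_def intro!: continuous_intros)

definition exp_sum :: "real \<Rightarrow> real ^ 'n \<Rightarrow> real" where
  "exp_sum \<beta> v = (\<Sum>i\<in>UNIV. exp (\<beta> * signed_coord i v))"

text \<open>Log-sum-exp with inverse temperature \<open>\<beta>\<close>. For
  \<open>\<beta> > 0\<close> it exceeds the maximum norm by at most
  \<open>ln (2 * CARD('n)) / \<beta>\<close>.\<close>

definition softmax :: "real \<Rightarrow> real ^ 'n \<Rightarrow> real" where
  "softmax \<beta> v = ln (exp_sum \<beta> v) / \<beta>"

text \<open>The Gibbs probabilities, which are the partial derivatives of log-sum-exp in the signed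
  coordinates taken as separate variables.\<close>

definition softmax_weight :: "real \<Rightarrow> real ^ 'n \<Rightarrow> 'n \<times> bool \<Rightarrow> real" where
  "softmax_weight \<beta> v i = exp (\<beta> * signed_coord i v) / exp_sum \<beta> v"

lemma exp_sum_pos: "exp_sum \<beta> v > 0"
  unfolding exp_sum_def by (intro sum_pos) auto

lemma softmax_weight_nonneg: "softmax_weight \<beta> v i \<ge> 0"
  using exp_sum_pos[of \<beta> v] by (simp add: softmax_weight_def)

lemma sum_softmax_weight: "(\<Sum>i\<in>UNIV. softmax_weight \<beta> v i) = 1"
  using exp_sum_pos[of \<beta> v] by (simp add: softmax_weight_def exp_sum_def flip: sum_divide_distrib)

lemma softmax_weight_le_1: "softmax_weight \<beta> v i \<le> 1"
  using member_le_sum[of i UNIV "softmax_weight \<beta> v"]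
  by (simp add: softmax_weight_nonneg sum_softmax_weight)

lemma continuous_on_exp_sum: "continuous_on UNIV (exp_sum \<beta>)"
  unfolding exp_sum_def by (intro continuous_intros)

lemma continuous_on_softmax: "continuous_on UNIV (softmax \<beta>)"
  unfolding softmax_def divide_inverse
  by (intro continuous_intros continuous_on_exp_sum) (auto simp: less_imp_neq[symmetric] exp_sum_pos)

lemma continuous_on_softmax_weight: "continuous_on UNIV (\<lambda>v. softmax_weight \<beta> v i)"
  unfolding softmax_weight_def
  by (intro continuous_intros continuous_on_exp_sum) (auto simp: less_imp_neq[symmetric] exp_sum_pos)

lemma softmax_0: "softmax \<beta> (0 :: real ^ 'n) = ln (2 * CARD('n)) / \<beta>"
  by (simp add: softmax_def exp_sum_def mult.commute)

lemma infnorm_le_softmax: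
  assumes "\<beta> > 0"
  shows "infnorm v \<le> softmax \<beta> v"
proof -
  obtain i where i: "infnorm v = signed_coord i v" using infnorm_eq_signed_coord by blast
  have "exp (\<beta> * infnorm v) \<le> exp_sum \<beta> v"
    unfolding exp_sum_def i by (rule member_le_sum) auto
  then have "\<beta> * infnorm v \<le> ln (exp_sum \<beta> v)"
    using exp_sum_pos[of \<beta> v] by (simp add: ln_ge_iff)
  then show ?thesis using assms by (simp add: softmax_def field_simps)
qed

text \<open>The quotient of \<open>exp_sum\<close> at \<open>v + h\<close> and at \<open>v\<close>
  is the mean of \<open>exp (\<beta> * signed_coord i h)\<close> under the weights. Hoeffding's
  lemma bounds it, so the quadratic upper bound is obtained without second derivatives.\<close>

lemma softmax_add_le:
  assumes "\<beta> > 0"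
  shows "softmax \<beta> (v + h) \<le>
    softmax \<beta> v + (\<Sum>i\<in>UNIV. softmax_weight \<beta> v i * signed_coord i h) + \<beta> / 2 * (infnorm h)\<^sup>2"
proof -
  define m where "m = (\<Sum>i\<in>UNIV. softmax_weight \<beta> v i * signed_coord i h)"
  have "exp_sum \<beta> (v + h) =
      exp_sum \<beta> v * (\<Sum>i\<in>UNIV. softmax_weight \<beta> v i * exp (\<beta> * signed_coord i h))"
    using exp_sum_pos[of \<beta> v]
    by (simp add: softmax_weight_def sum_distrib_left)
       (simp add: exp_sum_def signed_coord_add distrib_left exp_add)
  also have "\<dots> \<le> exp_sum \<beta> v *
      exp ((\<Sum>i\<in>UNIV. softmax_weight \<beta> v i * (\<beta> * signed_coord i h)) + (\<beta> * infnorm h)\<^sup>2 / 2)"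
    using exp_sum_pos[of \<beta> v] \<open>\<beta> > 0\<close> abs_signed_coord_le
    by (intro mult_left_mono sum_exp_le_Hoeffding softmax_weight_nonneg sum_softmax_weight)
       (auto simp: abs_mult)
  also have "(\<Sum>i\<in>UNIV. softmax_weight \<beta> v i * (\<beta> * signed_coord i h)) = \<beta> * m"
    by (simp add: m_def sum_distrib_left mult_ac)
  finally have "exp_sum \<beta> (v + h) \<le> exp_sum \<beta> v * exp (\<beta> * m + (\<beta> * infnorm h)\<^sup>2 / 2)" .
  then have "ln (exp_sum \<beta> (v + h)) \<le> ln (exp_sum \<beta> v * exp (\<beta> * m + (\<beta> * infnorm h)\<^sup>2 / 2))"
    using exp_sum_pos by (subst ln_le_cancel_iff) auto
  also have "\<dots> = ln (exp_sum \<beta> v) + (\<beta> * m + (\<beta> * infnorm h)\<^sup>2 / 2)"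
    using exp_sum_pos by (subst ln_mult_pos) auto
  finally have "softmax \<beta> (v + h) \<le> (ln (exp_sum \<beta> v) + (\<beta> * m + (\<beta> * infnorm h)\<^sup>2 / 2)) / \<beta>"
    using \<open>\<beta> > 0\<close> unfolding softmax_def by (intro divide_right_mono) auto
  also have "\<dots> = softmax \<beta> v + m + \<beta> / 2 * (infnorm h)\<^sup>2"
    using \<open>\<beta> > 0\<close> by (simp add: softmax_def field_simps power2_eq_square)
  finally show ?thesis by (simp add: m_def)
qed

lemma softmax_le:
  assumes "\<beta> > 0"
  shows "softmax \<beta> (v :: real ^ 'n) \<le> infnorm v + ln (2 * CARD('n)) / \<beta>"
proof -
  have "exp_sum \<beta> v \<le> (\<Sum>i\<in>(UNIV :: ('n \<times> bool) set). exp (\<beta> * infnorm v))"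
    unfolding exp_sum_def using assms abs_signed_coord_le[of _ v]
    by (intro sum_mono) (auto dest: abs_le_D1)
  also have "\<dots> = (2 * CARD('n)) * exp (\<beta> * infnorm v)" by simp
  finally have "ln (exp_sum \<beta> v) \<le> ln ((2 * CARD('n)) * exp (\<beta> * infnorm v))"
    using exp_sum_pos[of \<beta> v] by (subst ln_le_cancel_iff) auto
  also have "\<dots> = ln (2 * CARD('n)) + \<beta> * infnorm v"
    by (subst ln_mult_pos) auto
  finally show ?thesis
    using assms by (simp add: softmax_def field_simps)
qed

lemma borel_measurable_infnorm [measurable (raw)]:
  fixes f :: "'a \<Rightarrow> 'b::euclidean_space"
  assumes "f \<in> borel_measurable M"
  shows "(\<lambda>x. infnorm (f x)) \<in> borel_measurable M"
  using measurable_compose[OF assms borel_measurable_continuous_onI[of infnorm]]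
  by (simp add: continuous_on_infnorm continuous_on_id)

lemma integrable_infnorm:
  fixes f :: "'a \<Rightarrow> 'b::euclidean_space"
  assumes "integrable M f"
  shows "integrable M (\<lambda>x. infnorm (f x))"
  by (rule Bochner_Integration.integrable_bound[OF assms])
     (use assms infnorm_le_norm in \<open>auto simp: infnorm_pos_le\<close>)

text \<open>\<open>softmax\<close> lies between the maximum norm and that norm plus a constant, and
  constants are integrable for a finite measure.\<close>

lemma (in finite_measure) integrable_softmax:
  fixes f :: "'a \<Rightarrow> real ^ 'n"
  assumes f: "integrable M f" and "\<beta> > 0"
  shows "integrable M (\<lambda>x. softmax \<beta> (f x))"
proof (rule Bochner_Integration.integrable_bound)
  show "integrable M (\<lambda>x. infnorm (f x) + ln (2 * CARD('n)) / \<beta>)"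
    using integrable_infnorm[OF f] by simp
  show "(\<lambda>x. softmax \<beta> (f x)) \<in> borel_measurable M"
    by (rule measurable_compose[OF borel_measurable_integrable[OF f]
        borel_measurable_continuous_onI[OF continuous_on_softmax]])
  show "AE x in M. norm (softmax \<beta> (f x)) \<le> norm (infnorm (f x) + ln (2 * CARD('n)) / \<beta>)"
  proof (rule AE_I2)
    fix x
    show "norm (softmax \<beta> (f x)) \<le> norm (infnorm (f x) + ln (2 * CARD('n)) / \<beta>)"
      using softmax_le[OF \<open>\<beta> > 0\<close>, of "f x"] infnorm_le_softmax[OF \<open>\<beta> > 0\<close>, of "f x"]
        infnorm_pos_le[of "f x"] by simp
  qed
qed

text \<open>For \<open>b > 0\<close> the right-hand side is minimal at
  \<open>\<beta> = sqrt (2 * c / b)\<close>, written \<open>s / b\<close> below. For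
  \<open>b = 0\<close> there is no minimizer, and large \<open>\<beta>\<close> are used
  instead.\<close>

lemma le_sqrt_of_le_param:
  fixes a b c :: real
  assumes le: "\<And>\<beta>. \<beta> > 0 \<Longrightarrow> a \<le> c / \<beta> + \<beta> * b / 2" and "b \<ge> 0" "c > 0"
  shows "a \<le> sqrt (2 * c * b)"
proof (cases "b = 0")
  case True
  have "a \<le> 0"
  proof (rule ccontr)
    assume "\<not> a \<le> 0"
    \<comment> \<open>This choice of \<open>\<beta>\<close> yields
      \<open>a \<le> a / 2\<close>.\<close>
    then have "a \<le> c / (2 * c / a)" using le[of "2 * c / a"] True \<open>c > 0\<close> by simp
    then show False using \<open>\<not> a \<le> 0\<close> \<open>c > 0\<close> by simp
  qed
  then show ?thesis using True by simp
next
  case False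
  then have "b > 0" using assms by simp
  define s where "s = sqrt (2 * c * b)"
  have "s > 0" "s * s = 2 * c * b" using \<open>b > 0\<close> \<open>c > 0\<close> by (simp_all add: s_def)
  then have "c / (s / b) + s / b * b / 2 = s"
    using \<open>b > 0\<close> by (simp add: field_simps)
  with le[of "s / b"] \<open>s > 0\<close> \<open>b > 0\<close> show ?thesis by (simp add: s_def)
qed

text \<open>Vectors are added one at a time. The weights depend only on the earlier partial sum, so
  the linear term in the new vector has mean 0, and each addition costs at most
  \<open>\<beta> / 2 * s\<close>. The empty sum contributes the logarithm.\<close>

lemma (in prob_space) expectation_softmax_sum_le:
  fixes \<xi> :: "'i \<Rightarrow> 'a \<Rightarrow> real ^ 'n" and s :: real
  assumes "finite I" and indep: "indep_vars (\<lambda>_. borel) \<xi> I"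
    and int: "\<And>i. i \<in> I \<Longrightarrow> integrable M (\<xi> i)" and mean: "\<And>i. i \<in> I \<Longrightarrow> expectation (\<xi> i) = 0"
    and int2: "\<And>i. i \<in> I \<Longrightarrow> integrable M (\<lambda>\<omega>. (infnorm (\<xi> i \<omega>))\<^sup>2)"
    and var: "\<And>i. i \<in> I \<Longrightarrow> expectation (\<lambda>\<omega>. (infnorm (\<xi> i \<omega>))\<^sup>2) \<le> s"
    and "\<beta> > 0"
  shows "expectation (\<lambda>\<omega>. softmax \<beta> (\<Sum>i\<in>I. \<xi> i \<omega>)) \<le> ln (2 * CARD('n)) / \<beta> + \<beta> / 2 * (card I * s)"
proof -
  have meas [measurable]: "softmax \<beta> \<in> borel_measurable borel" "(\<lambda>v. softmax_weight \<beta> v k) \<in> borel_measurable borel"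
    "signed_coord k \<in> borel_measurable borel" for k :: "'n \<times> bool"
    by (auto intro!: borel_measurable_continuous_onI continuous_on_softmax continuous_on_softmax_weight
        continuous_intros)
  have int_softmax: "integrable M (\<lambda>\<omega>. softmax \<beta> (\<Sum>i\<in>J. \<xi> i \<omega>))" if "J \<subseteq> I" for J
    using that int \<open>\<beta> > 0\<close> by (intro integrable_softmax Bochner_Integration.integrable_sum) auto
  show ?thesis
    using \<open>finite I\<close> subset_refl[of I]
  proof (induction I rule: finite_subset_induct')
    case empty
    then show ?case by (simp add: softmax_0 prob_space)
  next
    case (insert i J)
    let ?S = "\<lambda>\<omega>. \<Sum>j\<in>J. \<xi> j \<omega>"
    have "indep_var borel ((\<lambda>f. \<Sum>j\<in>J. f j) \<circ> (\<lambda>\<omega>. restrict (\<lambda>j. \<xi> j \<omega>) J))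
        borel ((\<lambda>f. f i) \<circ> (\<lambda>\<omega>. restrict (\<lambda>j. \<xi> j \<omega>) {i}))"
      using insert.hyps by (intro indep_var_compose[OF indep_var_restrict[OF indep]]) auto
    also have "(\<lambda>f. \<Sum>j\<in>J. f j) \<circ> (\<lambda>\<omega>. restrict (\<lambda>j. \<xi> j \<omega>) J) = ?S"
      by (auto cong: rev_conj_cong)
    also have "(\<lambda>f. f i) \<circ> (\<lambda>\<omega>. restrict (\<lambda>j. \<xi> j \<omega>) {i}) = \<xi> i"
      by auto
    finally have ind: "indep_var borel ?S borel (\<xi> i)" .
    note [measurable] = indep_var_rv1[OF ind]
    have coord: "integrable M (\<lambda>\<omega>. signed_coord k (\<xi> i \<omega>)) \<and> expectation (\<lambda>\<omega>. signed_coord k (\<xi> i \<omega>)) = 0"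
      for k :: "'n \<times> bool"
    proof -
      have bl: "bounded_linear (\<lambda>v :: real ^ 'n. v $ fst k)" by (rule bounded_linear_vec_nth)
      show ?thesis
        using integrable_bounded_linear[OF bl int[OF \<open>i \<in> I\<close>]]
          integral_bounded_linear[OF bl int[OF \<open>i \<in> I\<close>]] mean[OF \<open>i \<in> I\<close>]
        by (cases "snd k") (auto simp: signed_coord_def)
    qed
    have cross: "integrable M (\<lambda>\<omega>. softmax_weight \<beta> (?S \<omega>) k * signed_coord k (\<xi> i \<omega>)) \<and>
        expectation (\<lambda>\<omega>. softmax_weight \<beta> (?S \<omega>) k * signed_coord k (\<xi> i \<omega>)) = 0" for k
    proof -
      have "indep_var borel ((\<lambda>v. softmax_weight \<beta> v k) \<circ> ?S) borel (signed_coord k \<circ> \<xi> i)"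
        by (rule indep_var_compose[OF ind]) measurable
      then have i': "indep_var borel (\<lambda>\<omega>. softmax_weight \<beta> (?S \<omega>) k) borel (\<lambda>\<omega>. signed_coord k (\<xi> i \<omega>))"
        by (simp add: comp_def)
      \<comment> \<open>Weights are bounded by 1, so their product with an independent integrable
        coordinate is integrable and its expectation factors.\<close>
      have w: "integrable M (\<lambda>\<omega>. softmax_weight \<beta> (?S \<omega>) k)"
        by (rule integrable_const_bound[of _ 1])
           (auto simp: softmax_weight_nonneg softmax_weight_le_1)
      show ?thesis
        using indep_var_lebesgue_integral[OF i' w] indep_var_integrable[OF i' w] coord by simp
    qed
    have "expectation (\<lambda>\<omega>. softmax \<beta> (\<Sum>j\<in>insert i J. \<xi> j \<omega>)) \<le>
        expectation (\<lambda>\<omega>. softmax \<beta> (?S \<omega>) +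
          (\<Sum>k\<in>UNIV. softmax_weight \<beta> (?S \<omega>) k * signed_coord k (\<xi> i \<omega>)) + \<beta> / 2 * (infnorm (\<xi> i \<omega>))\<^sup>2)"
    proof (rule integral_mono)
      show "integrable M (\<lambda>\<omega>. softmax \<beta> (\<Sum>j\<in>insert i J. \<xi> j \<omega>))"
        using insert.hyps by (intro int_softmax) auto
      show "integrable M (\<lambda>\<omega>. softmax \<beta> (?S \<omega>) +
          (\<Sum>k\<in>UNIV. softmax_weight \<beta> (?S \<omega>) k * signed_coord k (\<xi> i \<omega>)) + \<beta> / 2 * (infnorm (\<xi> i \<omega>))\<^sup>2)"
        using insert.hyps cross int2
        by (intro Bochner_Integration.integrable_add int_softmax Bochner_Integration.integrable_sum
            integrable_mult_right) auto
      show "softmax \<beta> (\<Sum>j\<in>insert i J. \<xi> j \<omega>) \<le> softmax \<beta> (?S \<omega>) +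
          (\<Sum>k\<in>UNIV. softmax_weight \<beta> (?S \<omega>) k * signed_coord k (\<xi> i \<omega>)) + \<beta> / 2 * (infnorm (\<xi> i \<omega>))\<^sup>2" for \<omega>
        using softmax_add_le[OF \<open>\<beta> > 0\<close>, of "?S \<omega>" "\<xi> i \<omega>"] insert.hyps by (simp add: add.commute)
    qed
    also have "\<dots> = expectation (\<lambda>\<omega>. softmax \<beta> (?S \<omega>)) + \<beta> / 2 * expectation (\<lambda>\<omega>. (infnorm (\<xi> i \<omega>))\<^sup>2)"
      using insert.hyps cross int2 int_softmax
      by (subst Bochner_Integration.integral_add, simp_all)+
    also have "\<dots> \<le> (ln (2 * CARD('n)) / \<beta> + \<beta> / 2 * (card J * s)) + \<beta> / 2 * s"
      using insert.IH var[OF \<open>i \<in> I\<close>] \<open>\<beta> > 0\<close> by (intro add_mono mult_left_mono) auto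
    also have "\<dots> = ln (2 * CARD('n)) / \<beta> + \<beta> / 2 * (card (insert i J) * s)"
      using insert.hyps by (simp add: algebra_simps)
    finally show ?case .
  qed
qed

text \<open>
  Smoothing the maximum norm by \<open>softmax\<close> loses only \<open>ln (2 d) / \<beta>\<close>, and independence
  cancels the first-order terms in the expansion of the smoothed norm along the sum.
\<close>
lemma (in prob_space) expectation_infnorm_sum_le:
  fixes \<xi> :: "'i \<Rightarrow> 'a \<Rightarrow> real ^ 'n" and s :: real
  assumes "finite I" and indep: "indep_vars (\<lambda>_. borel) \<xi> I"
    and int: "\<And>i. i \<in> I \<Longrightarrow> integrable M (\<xi> i)" and mean: "\<And>i. i \<in> I \<Longrightarrow> expectation (\<xi> i) = 0"
    and int2: "\<And>i. i \<in> I \<Longrightarrow> integrable M (\<lambda>\<omega>. (infnorm (\<xi> i \<omega>))\<^sup>2)"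
    and var: "\<And>i. i \<in> I \<Longrightarrow> expectation (\<lambda>\<omega>. (infnorm (\<xi> i \<omega>))\<^sup>2) \<le> s" and "s \<ge> 0"
  shows "expectation (\<lambda>\<omega>. infnorm (\<Sum>i\<in>I. \<xi> i \<omega>)) \<le> sqrt (2 * ln (2 * CARD('n)) * (card I * s))"
proof (rule le_sqrt_of_le_param)
  fix \<beta> :: real assume "\<beta> > 0"
  have S: "integrable M (\<lambda>\<omega>. \<Sum>i\<in>I. \<xi> i \<omega>)"
    using int by (intro Bochner_Integration.integrable_sum) auto
  have "expectation (\<lambda>\<omega>. infnorm (\<Sum>i\<in>I. \<xi> i \<omega>)) \<le> expectation (\<lambda>\<omega>. softmax \<beta> (\<Sum>i\<in>I. \<xi> i \<omega>))"
  proof (rule integral_mono')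
    show "integrable M (\<lambda>\<omega>. softmax \<beta> (\<Sum>i\<in>I. \<xi> i \<omega>))"
      by (rule integrable_softmax[OF S \<open>\<beta> > 0\<close>])
  qed (auto intro: infnorm_le_softmax[OF \<open>\<beta> > 0\<close>]
      order_trans[OF infnorm_pos_le infnorm_le_softmax[OF \<open>\<beta> > 0\<close>]])
  also have "\<dots> \<le> ln (2 * CARD('n)) / \<beta> + \<beta> / 2 * (card I * s)"
    by (rule expectation_softmax_sum_le[OF assms(1-6) \<open>\<beta> > 0\<close>])
  finally show "expectation (\<lambda>\<omega>. infnorm (\<Sum>i\<in>I. \<xi> i \<omega>)) \<le> ln (2 * CARD('n)) / \<beta> + \<beta> * (card I * s) / 2"
    by simp
next
  have "CARD('n) \<ge> 1" by (simp add: Suc_le_eq)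
  then show "ln (2 * CARD('n)) > (0 :: real)" by (intro ln_gt_zero) linarith
qed (use \<open>s \<ge> 0\<close> in simp)

text \<open>Moments of each sample are transferred from \<open>\<zeta>\<close> through the common
  distribution. The sum of centred terms is of order \<open>sqrt m\<close>, and dividing by
  \<open>m\<close> leaves \<open>1 / m\<close> under the root.\<close>

lemma (in prob_space) expectation_infnorm_average_le:
  fixes g :: "'z \<Rightarrow> real ^ 'n" and s :: real
  assumes "m > 0" and indep: "indep_vars (\<lambda>_. \<Xi>) Z {1..m}" and \<zeta>: "random_variable \<Xi> \<zeta>"
    and distr: "\<And>i. i \<in> {1..m} \<Longrightarrow> distr M \<Xi> (Z i) = distr M \<Xi> \<zeta>"
    and g [measurable]: "g \<in> borel_measurable \<Xi>" and int: "integrable M (\<lambda>\<omega>. g (\<zeta> \<omega>))"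
  defines "\<mu> \<equiv> expectation (\<lambda>\<omega>. g (\<zeta> \<omega>))"
  assumes int2: "integrable M (\<lambda>\<omega>. (infnorm (g (\<zeta> \<omega>) - \<mu>))\<^sup>2)"
    and var: "expectation (\<lambda>\<omega>. (infnorm (g (\<zeta> \<omega>) - \<mu>))\<^sup>2) \<le> s" and "s \<ge> 0"
  shows "integrable M (\<lambda>\<omega>. infnorm ((1 / real m) *\<^sub>R (\<Sum>i=1..m. g (Z i \<omega>)) - \<mu>))"
    and "expectation (\<lambda>\<omega>. infnorm ((1 / real m) *\<^sub>R (\<Sum>i=1..m. g (Z i \<omega>)) - \<mu>))
      \<le> sqrt (2 * ln (2 * CARD('n)) * s / m)"
proof -
  have Z: "random_variable \<Xi> (Z i)" if "i \<in> {1..m}" for i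
    using indep that unfolding indep_vars_def by auto
  have transfer: "integrable M (\<lambda>\<omega>. h (Z i \<omega>)) = integrable M (\<lambda>\<omega>. h (\<zeta> \<omega>))"
    "expectation (\<lambda>\<omega>. h (Z i \<omega>)) = expectation (\<lambda>\<omega>. h (\<zeta> \<omega>))"
    if "i \<in> {1..m}" "h \<in> borel_measurable \<Xi>" for i and h :: "'z \<Rightarrow> 'b::{banach, second_countable_topology}"
    using integrable_distr_eq[OF Z[OF that(1)] that(2)] integrable_distr_eq[OF \<zeta> that(2)]
      integral_distr[OF Z[OF that(1)] that(2)] integral_distr[OF \<zeta> that(2)] distr[OF that(1)]
    by simp_all
  define \<xi> where "\<xi> i \<omega> = g (Z i \<omega>) - \<mu>" for i \<omega>
  have gZ: "integrable M (\<lambda>\<omega>. g (Z i \<omega>))" if "i \<in> {1..m}" for i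
    using transfer(1)[OF that g] int by simp
  have avg: "(1 / real m) *\<^sub>R (\<Sum>i=1..m. g (Z i \<omega>)) - \<mu> = (1 / real m) *\<^sub>R (\<Sum>i=1..m. \<xi> i \<omega>)" for \<omega>
    using \<open>m > 0\<close> by (simp add: \<xi>_def sum_subtractf scaleR_diff_right sum_constant_scaleR del: sum_constant)
  have sum: "expectation (\<lambda>\<omega>. infnorm (\<Sum>i\<in>{1..m}. \<xi> i \<omega>)) \<le> sqrt (2 * ln (2 * CARD('n)) * (card {1..m} * s))"
  proof (rule expectation_infnorm_sum_le)
    show "indep_vars (\<lambda>_. borel) \<xi> {1..m}"
      unfolding \<xi>_def by (rule indep_vars_compose2[OF indep]) measurable
    show "integrable M (\<xi> i)" if "i \<in> {1..m}" for i
      using gZ[OF that] by (simp add: \<xi>_def[abs_def])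
    show "expectation (\<xi> i) = 0" if "i \<in> {1..m}" for i
      using gZ[OF that] transfer(2)[OF that g] by (simp add: \<xi>_def[abs_def] \<mu>_def prob_space)
    show "integrable M (\<lambda>\<omega>. (infnorm (\<xi> i \<omega>))\<^sup>2)" "expectation (\<lambda>\<omega>. (infnorm (\<xi> i \<omega>))\<^sup>2) \<le> s"
      if "i \<in> {1..m}" for i
      using transfer[OF that, of "\<lambda>z. (infnorm (g z - \<mu>))\<^sup>2"] int2 var by (simp_all add: \<xi>_def)
  qed (use \<open>s \<ge> 0\<close> in auto)
  have "integrable M (\<lambda>\<omega>. (1 / real m) *\<^sub>R (\<Sum>i=1..m. g (Z i \<omega>)) - \<mu>)"
    using gZ by (intro Bochner_Integration.integrable_diff integrable_scaleR_right
        Bochner_Integration.integrable_sum) auto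
  then show "integrable M (\<lambda>\<omega>. infnorm ((1 / real m) *\<^sub>R (\<Sum>i=1..m. g (Z i \<omega>)) - \<mu>))"
    by (rule integrable_infnorm)
  have "expectation (\<lambda>\<omega>. infnorm ((1 / real m) *\<^sub>R (\<Sum>i=1..m. g (Z i \<omega>)) - \<mu>)) =
      expectation (\<lambda>\<omega>. infnorm (\<Sum>i\<in>{1..m}. \<xi> i \<omega>)) / m"
    unfolding avg infnorm_mul by simp
  also have "\<dots> \<le> sqrt (2 * ln (2 * CARD('n)) * (m * s)) / m"
    using sum by (intro divide_right_mono) auto
  also have "\<dots> = sqrt (2 * ln (2 * CARD('n)) * (m * s) / (real m)\<^sup>2)"
    by (simp add: real_sqrt_divide)
  also have "2 * ln (2 * CARD('n)) * (m * s) / (real m)\<^sup>2 = 2 * ln (2 * CARD('n)) * s / m"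
    using \<open>m > 0\<close> by (simp add: power2_eq_square)
  finally show "expectation (\<lambda>\<omega>. infnorm ((1 / real m) *\<^sub>R (\<Sum>i=1..m. g (Z i \<omega>)) - \<mu>))
      \<le> sqrt (2 * ln (2 * CARD('n)) * s / m)" .
qed

text \<open>From \<open>2 \<le> d\<close> comes \<open>ln (2 * d) \<le> 2 * ln d\<close>, and
  \<open>4 \<le> (exp 1)\<^sup>2\<close> because \<open>2 \<le> exp 1\<close>.\<close>

lemma two_ln_double_le:
  assumes "d \<ge> (2 :: real)"
  shows "2 * ln (2 * d) \<le> (exp 1)\<^sup>2 * ln d"
proof -
  have "ln (2 * d) = ln 2 + ln d" using assms by (subst ln_mult_pos) auto
  moreover have "ln 2 \<le> ln d" using assms by simp
  ultimately have "2 * ln (2 * d) \<le> 2\<^sup>2 * ln d" by simp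
  also have "\<dots> \<le> (exp 1)\<^sup>2 * ln d"
    using exp_ge_add_one_self[of 1] assms by (intro mult_right_mono power_mono) auto
  finally show ?thesis .
qed

section \<open>Independence of generated sigma-algebras\<close>

lemma measurable_sigma_of_vimage_algebra:
  assumes "f \<in> \<Omega> \<rightarrow> space N" "sets (vimage_algebra \<Omega> f N) \<subseteq> B" "B \<subseteq> Pow \<Omega>"
  shows "f \<in> measurable (sigma \<Omega> B) N"
proof (rule measurableI)
  show "f x \<in> space N" if "x \<in> space (sigma \<Omega> B)" for x
    using that assms by (auto simp: space_measure_of)
  show "f -` C \<inter> space (sigma \<Omega> B) \<in> sets (sigma \<Omega> B)" if "C \<in> sets N" for C
    using in_vimage_algebra[OF that, of f \<Omega>] assms
    by (auto simp: space_measure_of sets_measure_of)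
qed

text \<open>Grouping of independent intersection-stable families into two disjoint blocks, indexed
  by \<open>bool\<close>.\<close>

lemma (in prob_space) indep_set_sigma_Un:
  assumes indep: "indep_sets E (A \<union> B)" and "A \<inter> B = {}"
    and stable: "\<And>s. s \<in> A \<union> B \<Longrightarrow> Int_stable (E s)"
  shows "indep_set (sigma_sets (space M) (\<Union>s\<in>A. E s)) (sigma_sets (space M) (\<Union>s\<in>B. E s))"
proof -
  have "indep_sets (\<lambda>b. sigma_sets (space M) (\<Union>s\<in>case_bool A B b. E s)) UNIV"
    using indep stable \<open>A \<inter> B = {}\<close>
    by (intro indep_sets_collect_sigma)
       (auto simp: UNIV_bool Un_commute disjoint_family_on_def split: bool.splits)
  also have "(\<lambda>b. sigma_sets (space M) (\<Union>s\<in>case_bool A B b. E s)) =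
      case_bool (sigma_sets (space M) (\<Union>s\<in>A. E s)) (sigma_sets (space M) (\<Union>s\<in>B. E s))"
    by (rule ext) (simp split: bool.split)
  finally show ?thesis
    by (simp add: indep_set_def)
qed

lemma (in prob_space) random_variable_of_sigma:
  assumes "U \<in> measurable (sigma (space M) A) S" "A \<subseteq> events"
  shows "random_variable S U"
  using subsetD[OF measurable_mono1[OF sets.space_closed assms(2)] assms(1)]
  by (simp add: measurable_def space_measure_of[OF sets.space_closed]
      sets_measure_of[OF sets.space_closed] sets.sigma_sets_eq)

text \<open>The product formula is stated on preimages so that \<open>U\<close> and \<open>V\<close>
  may take values in different types, as an iterate and a batch of samples do.\<close>

lemma (in prob_space) indep_set_sigma_vimage:
  assumes indep: "indep_set (sigma_sets (space M) A) (sigma_sets (space M) B)"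
    and U: "U \<in> measurable (sigma (space M) A) S" and V: "V \<in> measurable (sigma (space M) B) T"
  shows "random_variable S U" "random_variable T V"
    and "\<And>a b. a \<in> sets S \<Longrightarrow> b \<in> sets T \<Longrightarrow>
      prob ((U -` a \<inter> space M) \<inter> (V -` b \<inter> space M)) = prob (U -` a \<inter> space M) * prob (V -` b \<inter> space M)"
proof -
  have ev: "A \<subseteq> events" "B \<subseteq> events"
    using indep_setD_ev1[OF indep] indep_setD_ev2[OF indep] by (auto intro: sigma_sets.Basic)
  then have pow: "A \<subseteq> Pow (space M)" "B \<subseteq> Pow (space M)"
    using sets.space_closed by blast+
  show "random_variable S U" "random_variable T V"
    using random_variable_of_sigma U V ev by blast+
  fix a b assume "a \<in> sets S" "b \<in> sets T"
  then show "prob ((U -` a \<inter> space M) \<inter> (V -` b \<inter> space M)) = prob (U -` a \<inter> space M) * prob (V -` b \<inter> space M)"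
    using measurable_sets[OF U, of a] measurable_sets[OF V, of b] pow
    by (intro indep_setD[OF indep]) (simp_all add: space_measure_of sets_measure_of)
qed

lemma (in prob_space) indep_var_of_sigma:
  assumes indep: "indep_set (sigma_sets (space M) A) (sigma_sets (space M) B)"
    and U: "U \<in> measurable (sigma (space M) A) S" and V: "V \<in> measurable (sigma (space M) B) T"
  shows "indep_var S U T V"
  unfolding indep_var_eq
proof (intro conjI indep_set_sigma_sets)
  note rv = indep_set_sigma_vimage[OF indep U V]
  show "random_variable S U" "random_variable T V" by fact+
  show "indep_set {U -` a \<inter> space M | a. a \<in> sets S} {V -` b \<inter> space M | b. b \<in> sets T}"
    using rv(3) measurable_sets[OF rv(1)] measurable_sets[OF rv(2)]
    unfolding indep_sets2_eq by auto
  show "Int_stable {W -` a \<inter> space M | a. a \<in> sets N}" for W and N :: "'c measure"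
  proof (rule Int_stableI, safe)
    fix a b assume "a \<in> sets N" "b \<in> sets N"
    then show "\<exists>c. (W -` a \<inter> space M) \<inter> (W -` b \<inter> space M) = W -` c \<inter> space M \<and> c \<in> sets N"
      by (intro exI[of _ "a \<inter> b"]) auto
  qed
  then show "Int_stable {V -` b \<inter> space M | b. b \<in> sets T}" .
qed

text \<open>The joint law is the product of the marginals, so \<open>V\<close> can be integrated
  first with \<open>u\<close> frozen. This takes the place of conditioning on the past.\<close>

lemma (in prob_space) nn_integral_indep_le:
  assumes indep: "indep_set (sigma_sets (space M) A) (sigma_sets (space M) B)"
    and "U \<in> measurable (sigma (space M) A) S" and "V \<in> measurable (sigma (space M) B) T"
    and h: "h \<in> borel_measurable (S \<Otimes>\<^sub>M T)"
    and le: "\<And>u. u \<in> space S \<Longrightarrow> (\<integral>\<^sup>+\<omega>. h (u, V \<omega>) \<partial>M) \<le> C"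
  shows "(\<integral>\<^sup>+\<omega>. h (U \<omega>, V \<omega>) \<partial>M) \<le> C"
proof -
  note rv = indep_set_sigma_vimage[OF assms(1-3)]
  note U[measurable] = rv(1) and V[measurable] = rv(2)
  interpret T: prob_space "distr M T V" by (rule prob_space_distr) fact
  interpret S: prob_space "distr M S U" by (rule prob_space_distr) fact
  have eq: "distr M S U \<Otimes>\<^sub>M distr M T V = distr M (S \<Otimes>\<^sub>M T) (\<lambda>\<omega>. (U \<omega>, V \<omega>))" (is "_ = ?J")
  proof (rule pair_measure_eqI)
    show "sigma_finite_measure (distr M S U)" "sigma_finite_measure (distr M T V)" ..
    fix a b assume a: "a \<in> sets (distr M S U)" and b: "b \<in> sets (distr M T V)"
    have "emeasure ?J (a \<times> b) = emeasure M ((\<lambda>\<omega>. (U \<omega>, V \<omega>)) -` (a \<times> b) \<inter> space M)"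
      using a b by (intro emeasure_distr) auto
    also have "(\<lambda>\<omega>. (U \<omega>, V \<omega>)) -` (a \<times> b) \<inter> space M = (U -` a \<inter> space M) \<inter> (V -` b \<inter> space M)"
      by auto
    also have "emeasure M \<dots> = emeasure M (U -` a \<inter> space M) * emeasure M (V -` b \<inter> space M)"
      using rv(3)[of a b] a b by (simp add: emeasure_eq_measure measure_nonneg ennreal_mult)
    also have "\<dots> = emeasure (distr M S U) a * emeasure (distr M T V) b"
      using a b by (simp add: emeasure_distr)
    finally show "emeasure (distr M S U) a * emeasure (distr M T V) b = emeasure ?J (a \<times> b)" by simp
  qed simp
  have h': "h \<in> borel_measurable (distr M S U \<Otimes>\<^sub>M distr M T V)"
    using h by (simp cong: measurable_cong_sets)
  have "(\<integral>\<^sup>+\<omega>. h (U \<omega>, V \<omega>) \<partial>M) = (\<integral>\<^sup>+p. h p \<partial>(distr M S U \<Otimes>\<^sub>M distr M T V))"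
    unfolding eq using h by (subst nn_integral_distr) auto
  also have "\<dots> = (\<integral>\<^sup>+u. (\<integral>\<^sup>+v. h (u, v) \<partial>distr M T V) \<partial>distr M S U)"
    by (rule T.nn_integral_fst[OF h', symmetric])
  also have "\<dots> \<le> (\<integral>\<^sup>+u. C \<partial>distr M S U)"
  proof (rule nn_integral_mono)
    fix u assume "u \<in> space (distr M S U)"
    then have u: "u \<in> space S" by simp
    then have "(\<lambda>v. h (u, v)) \<in> borel_measurable T" using h by measurable
    then show "(\<integral>\<^sup>+v. h (u, v) \<partial>distr M T V) \<le> C"
      using le[OF u] by (simp add: nn_integral_distr)
  qed
  finally show ?thesis using S.emeasure_space_1 by simp
qed

section \<open>The convergence bound\<close>

theorem theorem3:
  fixes M :: "'w measure" and \<Xi> :: "'z measure"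
    and X :: "(real ^ 'n) set"
    and F :: "real ^ 'n \<Rightarrow> 'z \<Rightarrow> real"
    and f :: "real ^ 'n \<Rightarrow> real"
    and gradf :: "real ^ 'n \<Rightarrow> real ^ 'n"
    and G :: "real ^ 'n \<Rightarrow> 'z \<Rightarrow> real ^ 'n"
    and \<zeta> :: "'w \<Rightarrow> 'z"
    and zs :: "nat \<Rightarrow> nat \<Rightarrow> 'w \<Rightarrow> 'z"
    and x :: "nat \<Rightarrow> 'w \<Rightarrow> real ^ 'n"
    and Y :: "'w \<Rightarrow> nat"
    and K :: nat and m :: "nat \<Rightarrow> nat" and \<psi> :: "nat \<Rightarrow> real"
    and \<eta> L f_low sigma_sq :: real
  assumes "CARD('n) \<ge> 2"
    and "X \<noteq> {}" and "closed X" and "convex X"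
    and "prob_space M"
    and "\<zeta> \<in> measurable M \<Xi>"
    and "\<And>y. integrable M (\<lambda>\<omega>. F y (\<zeta> \<omega>))"
    and "\<And>y. f y = (LINT \<omega>|M. F y (\<zeta> \<omega>))"
    and "\<And>y. GDERIV f y :> gradf y"
    and "(\<lambda>(y, z). G y z) \<in> borel_measurable (restrict_space borel X \<Otimes>\<^sub>M \<Xi>)"
    and "\<And>y. y \<in> X \<Longrightarrow> integrable M (\<lambda>\<omega>. G y (\<zeta> \<omega>))"
    and "\<And>y. y \<in> X \<Longrightarrow> (LINT \<omega>|M. G y (\<zeta> \<omega>)) = gradf y"
    and "\<And>y. y \<in> X \<Longrightarrow> integrable M (\<lambda>\<omega>. (infnorm (G y (\<zeta> \<omega>) - gradf y))\<^sup>2)"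
    and "bdd_above ((\<lambda>y. LINT \<omega>|M. (infnorm (G y (\<zeta> \<omega>) - gradf y))\<^sup>2) ` X)"
    and "sigma_sq = (SUP y\<in>X. LINT \<omega>|M. (infnorm (G y (\<zeta> \<omega>) - gradf y))\<^sup>2)"
    and "L \<ge> 0"
    and "\<And>y z. y \<in> X \<Longrightarrow> z \<in> X \<Longrightarrow> infnorm (gradf y - gradf z) \<le> L * l1norm (y - z)"
    and "\<And>y. y \<in> X \<Longrightarrow> f_low \<le> f y"
    and "K > 0" and "\<eta> > 0"
    and "\<And>k. k \<in> {1..K} \<Longrightarrow> \<psi> k > 0"
    and "\<And>k. k \<in> {1..K} \<Longrightarrow> m k > 0"
    and "x 1 \<in> borel_measurable M"
    and "\<And>\<omega>. \<omega> \<in> space M \<Longrightarrow> x 1 \<omega> \<in> X"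
    and "integrable M (\<lambda>\<omega>. f (x 1 \<omega>))"
    and "\<And>k i. k \<in> {1..K} \<Longrightarrow> i \<in> {1..m k} \<Longrightarrow> zs k i \<in> measurable M \<Xi>"
    and "\<And>k i. k \<in> {1..K} \<Longrightarrow> i \<in> {1..m k} \<Longrightarrow> distr M \<Xi> (zs k i) = distr M \<Xi> \<zeta>"
    and "Y \<in> measurable M (count_space {1..K})"
    and "\<And>k. k \<in> {1..K} \<Longrightarrow> measure M {\<omega> \<in> space M. Y \<omega> = k} = \<psi> k / (\<Sum>j=1..K. \<psi> j)"
    and "prob_space.indep_sets M (generated_events M \<Xi> (x 1) zs Y)
           ({Initial, Output_Index} \<union> {Sample k i | k i. k \<in> {1..K} \<and> i \<in> {1..m k}})"
    and "\<And>k \<omega>. k \<in> {1..K} \<Longrightarrow> \<omega> \<in> space M \<Longrightarrow>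
           prox_step X \<eta> (delta {z. l1norm z \<le> \<psi> k})
             (minibatch G (m k) (x k \<omega>) (\<lambda>i. zs k i \<omega>)) (x k \<omega>) (x (k + 1) \<omega>)"
  shows "integrable M (\<lambda>\<omega>. infdist0 (frechet_subdiff (\<lambda>y. ereal (f y) + delta X y) (x (Y \<omega> + 1) \<omega>))) \<and>
    (LINT \<omega>|M. infdist0 (frechet_subdiff (\<lambda>y. ereal (f y) + delta X y) (x (Y \<omega> + 1) \<omega>)))
      \<le> (3 * L / 2 + 1 / \<eta>) * ((\<Sum>k=1..K. (\<psi> k)\<^sup>2) / (\<Sum>k=1..K. \<psi> k))
        + ((LINT \<omega>|M. f (x 1 \<omega>)) - f_low) / (\<Sum>k=1..K. \<psi> k)
        + (2 * (\<Sum>k=1..K. \<psi> k / sqrt (real (m k)))) / (\<Sum>k=1..K. \<psi> k)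
            * sqrt ((exp 1)\<^sup>2 * ln (real CARD('n)) * sigma_sq)"
proof -
  note X = assms(4,3)
  note GM = assms(10) and Lip = assms(17) and K = assms(19) and \<eta> = assms(20)
  note \<psi> = assms(21) and m = assms(22) and zs = assms(26) and Y = assms(28) and PY = assms(29)
  note indep = assms(30) and step = assms(31)
  interpret prob_space M by fact

  \<comment> \<open>Notation and measurability of the problem data\<close>
  define c where "c = 3 * L / 2 + 1 / \<eta>"
  define \<Psi> where "\<Psi> = (\<Sum>k=1..K. \<psi> k)"
  have "\<Psi> > 0" unfolding \<Psi>_def using K \<psi> by (intro sum_pos) auto
  \<comment> \<open>The oracle is measurable only over \<open>X\<close>, so iterates are regarded as
    random elements of this restricted space.\<close>
  define N where "N = restrict_space borel X"
  have space_N: "space N = X" by (simp add: N_def space_restrict_space)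
  define g where "g k \<omega> = minibatch G (m k) (x k \<omega>) (\<lambda>i. zs k i \<omega>)" for k \<omega>
  define \<delta> where "\<delta> k \<omega> = infnorm (g k \<omega> - gradf (x k \<omega>))" for k \<omega>
  define D where "D y = infdist0 ((+) (gradf y) ` normal_cone X y)" for y
  have D_eq: "infdist0 (frechet_subdiff (\<lambda>y. ereal (f y) + delta X y) y) = D y" if "y \<in> X" for y
    unfolding D_def by (subst frechet_subdiff_add_delta[OF X(1) that assms(9)]) simp
  have D_nonneg: "D y \<ge> 0" for y
    unfolding D_def using zero_in_normal_cone by (intro infdist0_nonneg) blast
  have cont: "continuous_on X gradf"
    by (rule continuous_on_l1_infnorm_lipschitz[OF Lip])
  have D_meas: "D \<in> borel_measurable N"
    unfolding D_def N_def by (rule borel_measurable_infdist0_normal_cone[OF X(2) cont])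
  have gradf_meas: "gradf \<in> borel_measurable N"
    unfolding N_def by (rule borel_measurable_continuous_on_restrict[OF cont])
  have G_meas: "(\<lambda>(y, z). G y z) \<in> borel_measurable (N \<Otimes>\<^sub>M \<Xi>)"
    using GM unfolding N_def .

  \<comment> \<open>Feasibility of the iterates\<close>
  have xX: "x (Suc k) \<omega> \<in> X" if "k \<le> K" "\<omega> \<in> space M" for k \<omega>
    using that(1)
  proof (induction k)
    case 0
    then show ?case using assms(24) that by simp
  next
    case (Suc k)
    then have k: "Suc k \<in> {1..K}" by simp
    show ?case
      using prox_step_eq_closest_point(2)[OF X(1,2) Suc.IH \<psi>[OF k] step[OF k that(2)]] Suc by simp
  qed
  then have xX: "x k \<omega> \<in> X" if "k \<in> {1..K + 1}" "\<omega> \<in> space M" for k \<omega>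
    using that by (cases k) auto

  \<comment> \<open>Sigma-algebras generated by the sources of randomness\<close>
  define E where "E = generated_events M \<Xi> (x 1) zs Y"
  \<comment> \<open>The sources that determine \<open>x k\<close>: samples of rounds strictly before
    \<open>k\<close>. The batch \<open>cur k\<close> is still fresh, and the output index never
    belongs to a past.\<close>
  define past where "past k = insert Initial {Sample j i | j i. j \<in> {1..K} \<and> j < k \<and> i \<in> {1..m j}}" for k
  define cur where "cur k = {Sample k i | i. i \<in> {1..m k}}" for k
  define all where "all = {Initial, Output_Index} \<union> {Sample k i | k i. k \<in> {1..K} \<and> i \<in> {1..m k}}"
  define H where "H A = sigma (space M) (\<Union>s\<in>A. E s)" for A
  have past_all: "past k \<subseteq> all" for k by (auto simp: past_def all_def)
  have cur_all: "cur k \<subseteq> all" if "k \<in> {1..K}" for k using that by (auto simp: cur_def all_def)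
  have past_Suc: "past (Suc k) = past k \<union> cur k" if "k \<in> {1..K}" for k
    using that by (auto simp: past_def cur_def less_Suc_eq)
  have indepE: "indep_sets E all" using indep by (simp add: E_def all_def)
  have E_sets: "\<exists>N. E s = sets N" for s :: source
    unfolding E_def by (cases s) auto
  have stable: "Int_stable (E s)" for s
  proof -
    obtain A where "E s = sets A" using E_sets by blast
    then show ?thesis by (simp add: sets.Int_stable)
  qed
  have E_events: "(\<Union>s\<in>A. E s) \<subseteq> events" if "A \<subseteq> all" for A
    using indepE that unfolding indep_sets_def by auto
  have E_pow: "(\<Union>s\<in>A. E s) \<subseteq> Pow (space M)" if "A \<subseteq> all" for A
    by (rule order_trans[OF E_events[OF that] sets.space_closed])
  have space_H: "space (H A) = space M" if "A \<subseteq> all" for A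
    unfolding H_def by (rule space_measure_of[OF E_pow[OF that]])
  have H_mono: "measurable (H A) N' \<subseteq> measurable (H B) N'" if "A \<subseteq> B" "B \<subseteq> all" for A B and N' :: "'b measure"
    unfolding H_def using that by (intro measurable_mono1 E_pow) auto
  have H_M: "measurable (H A) N' \<subseteq> measurable M N'" if "A \<subseteq> all" for A and N' :: "'b measure"
  proof -
    have "sets (H A) \<subseteq> sets M"
      unfolding H_def using E_pow[OF that] E_events[OF that] by (simp add: sets_measure_of sets.sigma_sets_subset)
    then show ?thesis by (intro measurable_mono) (auto simp: space_H[OF that])
  qed
  have x1_H: "x 1 \<in> borel_measurable (H (past 1))"
    unfolding H_def
  proof (rule measurable_sigma_of_vimage_algebra)
    have "E Initial = sets (vimage_algebra (space M) (x 1) borel)" by (simp add: E_def)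
    then show "sets (vimage_algebra (space M) (x 1) borel) \<subseteq> (\<Union>s\<in>past 1. E s)"
      unfolding past_def by blast
  qed (use E_pow[OF past_all] in auto)
  have zs_H: "zs k i \<in> measurable (H A) \<Xi>" if "Sample k i \<in> A" "A \<subseteq> all" for k i A
    unfolding H_def
  proof (rule measurable_sigma_of_vimage_algebra)
    have "k \<in> {1..K}" "i \<in> {1..m k}" using that by (auto simp: all_def)
    from measurable_space[OF zs[OF this]] show "zs k i \<in> space M \<rightarrow> space \<Xi>" by blast
    have "E (Sample k i) = sets (vimage_algebra (space M) (zs k i) \<Xi>)" by (simp add: E_def)
    then show "sets (vimage_algebra (space M) (zs k i) \<Xi>) \<subseteq> (\<Union>s\<in>A. E s)"
      using that by blast
  qed (use E_pow that in auto)
  have Y_H: "Y \<in> measurable (H {Output_Index}) (count_space UNIV)"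
    unfolding H_def
    by (rule measurable_sigma_of_vimage_algebra)
       (use E_pow[of "{Output_Index}"] in \<open>auto simp: E_def all_def\<close>)

  \<comment> \<open>Adaptedness of gradient estimates and iterates\<close>
  have g_H: "g k \<in> borel_measurable (H A)"
    if "k \<in> {1..K}" "x k \<in> measurable (H A) N" "cur k \<subseteq> A" "A \<subseteq> all" for k A
  proof -
    have "(\<lambda>\<omega>. G (x k \<omega>) (zs k i \<omega>)) \<in> borel_measurable (H A)" if "i \<in> {1..m k}" for i
    proof -
      have "zs k i \<in> measurable (H A) \<Xi>"
        using \<open>cur k \<subseteq> A\<close> \<open>A \<subseteq> all\<close> that by (intro zs_H) (auto simp: cur_def)
      from measurable_compose[OF measurable_Pair[OF \<open>x k \<in> measurable (H A) N\<close> this] G_meas]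
      show ?thesis by simp
    qed
    then show ?thesis
      unfolding g_def minibatch_def by (intro borel_measurable_scaleR borel_measurable_sum) auto
  qed

  have x_H': "x (Suc k) \<in> measurable (H (past (Suc k))) N" if "k \<le> K" for k
    using that
  proof (induction k)
    case 0
    then show ?case
      using x1_H xX space_H[OF past_all] K unfolding N_def
      by (intro measurable_restrict_space2) auto
  next
    case (Suc k)
    let ?k = "Suc k" and ?H = "H (past (Suc (Suc k)))"
    have k: "?k \<in> {1..K}" using Suc.prems by simp
    have xk: "x ?k \<in> measurable ?H N"
      using Suc H_mono[of "past ?k" "past (Suc ?k)" N] past_all past_Suc[OF k] by auto
    have gk: "g ?k \<in> borel_measurable ?H"
      by (rule g_H[OF k xk]) (use past_Suc[OF k] past_all in auto)
    \<comment> \<open>The centre \<open>x ?k\<close> and the projected point are both random, hence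
      the projection is treated as a function of the pair.\<close>
    let ?P = "\<lambda>(y, u). closest_point (X \<inter> {z. l1norm (z - y) \<le> \<psi> ?k}) u"
    have P: "?P \<in> borel_measurable (restrict_space borel (X \<times> UNIV))"
      by (intro borel_measurable_continuous_on_restrict continuous_on_closest_point_l1_ball X \<psi> k)
    have "(\<lambda>\<omega>. (x ?k \<omega>, x ?k \<omega> - \<eta> *\<^sub>R g ?k \<omega>)) \<in> measurable ?H (restrict_space borel (X \<times> UNIV))"
    proof (rule measurable_restrict_space2)
      show "(\<lambda>\<omega>. (x ?k \<omega>, x ?k \<omega> - \<eta> *\<^sub>R g ?k \<omega>)) \<in> space ?H \<rightarrow> X \<times> UNIV"
        using xX[of ?k] k by (auto simp: space_H[OF past_all])
      have "x ?k \<in> borel_measurable ?H"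
        using xk unfolding N_def measurable_restrict_space2_iff by blast
      then show "(\<lambda>\<omega>. (x ?k \<omega>, x ?k \<omega> - \<eta> *\<^sub>R g ?k \<omega>)) \<in> borel_measurable ?H"
        using gk by measurable
    qed
    from measurable_compose[OF this P]
    have "(\<lambda>\<omega>. ?P (x ?k \<omega>, x ?k \<omega> - \<eta> *\<^sub>R g ?k \<omega>)) \<in> borel_measurable ?H" .
    moreover have "x (Suc ?k) \<omega> = ?P (x ?k \<omega>, x ?k \<omega> - \<eta> *\<^sub>R g ?k \<omega>)" if "\<omega> \<in> space ?H" for \<omega>
      using prox_step_eq_closest_point(1)[OF X _ \<psi>[OF k] step[OF k]] that xX[of ?k \<omega>] k
      by (simp add: g_def space_H[OF past_all])
    ultimately have "x (Suc ?k) \<in> borel_measurable ?H"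
      by (subst measurable_cong) auto
    then show ?case
      unfolding N_def using xX[of "Suc ?k"] k
      by (intro measurable_restrict_space2) (auto simp: space_H[OF past_all])
  qed
  then have x_H: "x k \<in> measurable (H (past k)) N" if "k \<in> {1..K + 1}" for k
    using that by (cases k) auto
  have x_M: "x k \<in> measurable M N" if "k \<in> {1..K + 1}" for k
    using x_H[OF that] H_M[OF past_all] by blast
  have \<delta>_M: "\<delta> k \<in> borel_measurable M" if "k \<in> {1..K}" for k
  proof -
    have "g k \<in> borel_measurable (H (past (Suc k)))"
      using that past_Suc[OF that] past_all H_mono[of "past k" "past (Suc k)" N] x_H[of k]
      by (intro g_H) auto
    then have "g k \<in> borel_measurable M" using H_M[OF past_all] by blast
    moreover have "(\<lambda>\<omega>. gradf (x k \<omega>)) \<in> borel_measurable M"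
      using that by (intro measurable_compose[OF x_M gradf_meas]) simp
    ultimately show ?thesis unfolding \<delta>_def by measurable
  qed

  \<comment> \<open>Expected error of the minibatch gradients\<close>
  define C where "C k = sqrt (2 * ln (2 * CARD('n)) * sigma_sq / m k)" for k
  have var: "(LINT \<omega>|M. (infnorm (G y (\<zeta> \<omega>) - gradf y))\<^sup>2) \<le> sigma_sq" if "y \<in> X" for y
    unfolding assms(15) using that by (intro cSUP_upper assms(14))
  have "sigma_sq \<ge> 0"
  proof -
    obtain y where "y \<in> X" using assms(2) by blast
    have "0 \<le> (LINT \<omega>|M. (infnorm (G y (\<zeta> \<omega>) - gradf y))\<^sup>2)" by simp
    then show ?thesis using var[OF \<open>y \<in> X\<close>] by linarith
  qed
  have noise: "integrable M (\<delta> k) \<and> expectation (\<delta> k) \<le> C k" if k: "k \<in> {1..K}" for k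
  proof -
    let ?T = "PiM {1..m k} (\<lambda>_. \<Xi>)"
    let ?V = "\<lambda>\<omega>. \<lambda>i\<in>{1..m k}. zs k i \<omega>"
    let ?h = "\<lambda>(y, z). ennreal (infnorm (minibatch G (m k) y z - gradf y))"
    \<comment> \<open>The batch becomes an element of a finite product space;
      \<open>minibatch\<close> reads only indices in \<open>{1..m k}\<close>, so restricting the
      family changes nothing.\<close>
    have mb: "minibatch G (m k) y (?V \<omega>) = minibatch G (m k) y (\<lambda>i. zs k i \<omega>)" for y \<omega>
      by (simp add: minibatch_def)
    have V: "?V \<in> measurable (H (cur k)) ?T"
      using cur_all[OF k] by (intro measurable_restrict zs_H) (auto simp: cur_def)
    have ind: "indep_set (sigma_sets (space M) (\<Union>s\<in>past k. E s)) (sigma_sets (space M) (\<Union>s\<in>cur k. E s))"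
      using past_all cur_all[OF k] stable
      by (intro indep_set_sigma_Un indep_sets_mono_index[OF _ indepE]) (auto simp: past_def cur_def)
    \<comment> \<open>Each sample is a block of its own, which brings the independence of the
      sources into the form of \<open>indep_vars\<close>.\<close>
    have "indep_sets (\<lambda>i. sigma_sets (space M) (\<Union>s\<in>{Sample k i}. E s)) {1..m k}"
      using k by (intro indep_sets_collect_sigma indep_sets_mono_index[OF _ indepE] stable)
        (auto simp: all_def disjoint_family_on_def)
    also have "?this \<longleftrightarrow>
        indep_sets (\<lambda>i. sigma_sets (space M) {zs k i -` A \<inter> space M | A. A \<in> sets \<Xi>}) {1..m k}"
    proof (intro indep_sets_cong refl arg_cong[where f = "sigma_sets (space M)"])
      fix i assume "i \<in> {1..m k}"
      then show "(\<Union>s\<in>{Sample k i}. E s) = {zs k i -` A \<inter> space M | A. A \<in> sets \<Xi>}"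
        using measurable_space[OF zs[OF k]] by (simp add: E_def sets_vimage_algebra2 Pi_iff)
    qed
    finally have zs_ind: "indep_vars (\<lambda>_. \<Xi>) (zs k) {1..m k}"
      unfolding indep_vars_def using zs[OF k] by blast
    \<comment> \<open>The iterate depends on \<open>past k\<close> and the batch on
      \<open>cur k\<close>, so it suffices to bound the error at each fixed \<open>y\<close> in
      \<open>X\<close>.\<close>
    have "(\<integral>\<^sup>+\<omega>. ?h (x k \<omega>, ?V \<omega>) \<partial>M) \<le> ennreal (C k)"
    proof (rule nn_integral_indep_le[OF ind x_H[unfolded H_def] V[unfolded H_def]])
      have "(\<lambda>p. G (fst p) (snd p i)) \<in> borel_measurable (N \<Otimes>\<^sub>M ?T)" if "i \<in> {1..m k}" for i
      proof -
        have "(\<lambda>p. (fst p, snd p i)) \<in> measurable (N \<Otimes>\<^sub>M ?T) (N \<Otimes>\<^sub>M \<Xi>)"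
          using that by measurable
        from measurable_compose[OF this G_meas] show ?thesis by simp
      qed
      then have "(\<lambda>p. minibatch G (m k) (fst p) (snd p)) \<in> borel_measurable (N \<Otimes>\<^sub>M ?T)"
        unfolding minibatch_def by (intro borel_measurable_scaleR borel_measurable_sum) auto
      moreover have "(\<lambda>p. gradf (fst p)) \<in> borel_measurable (N \<Otimes>\<^sub>M ?T)"
        by (rule measurable_compose[OF measurable_fst gradf_meas])
      ultimately show "?h \<in> borel_measurable (N \<Otimes>\<^sub>M ?T)"
        unfolding case_prod_beta by measurable
    next
      show "k \<in> {1..K + 1}" using k by simp
    next
      fix y assume "y \<in> space N"
      then have y: "y \<in> X" by (simp add: space_N)
      have Gy: "G y \<in> borel_measurable \<Xi>"
        using measurable_compose[OF measurable_Pair1'[OF \<open>y \<in> space N\<close>] G_meas] by simp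
      note avg = expectation_infnorm_average_le[OF m[OF k] zs_ind assms(6) assms(27)[OF k] Gy assms(11)[OF y],
          unfolded assms(12)[OF y], OF _ assms(13)[OF y] var[OF y] \<open>sigma_sq \<ge> 0\<close>]
      have "(\<integral>\<^sup>+\<omega>. ?h (y, ?V \<omega>) \<partial>M) =
          ennreal (expectation (\<lambda>\<omega>. infnorm ((1 / real (m k)) *\<^sub>R (\<Sum>i=1..m k. G y (zs k i \<omega>)) - gradf y)))"
        using avg(1) by (simp add: mb minibatch_def nn_integral_eq_integral infnorm_pos_le)
      also have "\<dots> \<le> ennreal (C k)"
        unfolding C_def using avg(2) by (intro ennreal_leI) auto
      finally show "(\<integral>\<^sup>+\<omega>. ?h (y, ?V \<omega>) \<partial>M) \<le> ennreal (C k)" .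
    qed
    then have le: "(\<integral>\<^sup>+\<omega>. ennreal (\<delta> k \<omega>) \<partial>M) \<le> ennreal (C k)"
      by (simp add: \<delta>_def g_def minibatch_def)
    have pos: "\<delta> k \<omega> \<ge> 0" for \<omega> by (simp add: \<delta>_def infnorm_pos_le)
    have int: "integrable M (\<delta> k)"
      using le \<delta>_M[OF k] pos by (intro integrableI_nonneg) (auto simp: le_less_trans)
    moreover have "ennreal (expectation (\<delta> k)) \<le> ennreal (C k)"
      using le int pos by (simp add: nn_integral_eq_integral)
    moreover have "C k \<ge> 0"
      unfolding C_def using \<open>sigma_sq \<ge> 0\<close> assms(1)
      by (intro real_sqrt_ge_zero divide_nonneg_nonneg mult_nonneg_nonneg ln_ge_zero) auto
    ultimately show ?thesis by simp
  qed

  \<comment> \<open>Pathwise telescoping and integrability\<close>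
  define R where "R \<omega> = (f (x 1 \<omega>) - f_low) + c * (\<Sum>k=1..K. (\<psi> k)\<^sup>2) + 2 * (\<Sum>k=1..K. \<psi> k * \<delta> k \<omega>)" for \<omega>
  have path: "(\<Sum>k=1..K. \<psi> k * D (x (Suc k) \<omega>)) \<le> R \<omega>" if \<omega>: "\<omega> \<in> space M" for \<omega>
  proof -
    have one: "\<psi> k * D (x (Suc k) \<omega>) \<le>
        f (x k \<omega>) - f (x (Suc k) \<omega>) + c * (\<psi> k)\<^sup>2 + 2 * (\<psi> k * \<delta> k \<omega>)" if k: "k \<in> {1..K}" for k
    proof -
      have xk: "x k \<omega> \<in> X" using xX[OF _ \<omega>] k by simp
      obtain v where v: "v \<in> normal_cone X (x (k + 1) \<omega>)" and le: "\<psi> k * infnorm (gradf (x (k + 1) \<omega>) + v) \<le>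
          f (x k \<omega>) - f (x (k + 1) \<omega>) + (3 * L / 2 + 1 / \<eta>) * (\<psi> k)\<^sup>2 + 2 * (\<psi> k * infnorm (g k \<omega> - gradf (x k \<omega>)))"
        using prox_step_stationarity[OF X xk \<psi>[OF k] \<eta> assms(9) Lip assms(16) step[OF k \<omega>], folded g_def] by blast
      have "\<psi> k * D (x (k + 1) \<omega>) \<le> \<psi> k * infnorm (gradf (x (k + 1) \<omega>) + v)"
        unfolding D_def using v \<psi>[OF k] by (intro mult_left_mono infdist0_le) auto
      with le show ?thesis by (simp add: c_def \<delta>_def)
    qed
    have "(\<Sum>k=1..K. \<psi> k * D (x (Suc k) \<omega>)) \<le>
        (\<Sum>k=1..K. f (x k \<omega>) - f (x (Suc k) \<omega>) + c * (\<psi> k)\<^sup>2 + 2 * (\<psi> k * \<delta> k \<omega>))"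
      by (intro sum_mono one)
    also have "\<dots> = (\<Sum>k=1..K. f (x k \<omega>) - f (x (Suc k) \<omega>)) + c * (\<Sum>k=1..K. (\<psi> k)\<^sup>2) + 2 * (\<Sum>k=1..K. \<psi> k * \<delta> k \<omega>)"
      by (simp add: sum.distrib sum_distrib_left)
    also have "(\<Sum>k=1..K. f (x k \<omega>) - f (x (Suc k) \<omega>)) = f (x 1 \<omega>) - f (x (Suc K) \<omega>)"
      using sum_Suc_diff[of 1 K "\<lambda>k. - f (x k \<omega>)"] by simp
    also have "\<dots> \<le> f (x 1 \<omega>) - f_low"
      using assms(18)[OF xX[OF _ \<omega>, of "Suc K"]] by simp
    finally show ?thesis by (simp add: R_def)
  qed
  have R_int: "integrable M R"
    unfolding R_def using noise assms(25)
    by (intro Bochner_Integration.integrable_add Bochner_Integration.integrable_diff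
        integrable_mult_right Bochner_Integration.integrable_sum) auto
  have D_M: "(\<lambda>\<omega>. D (x (Suc k) \<omega>)) \<in> borel_measurable M" if "k \<in> {1..K}" for k
    using that by (intro measurable_compose[OF x_M D_meas]) simp
  \<comment> \<open>All summands in \<open>path\<close> are nonnegative, so a single one is
    dominated by the integrable \<open>R\<close>.\<close>
  have D_int: "integrable M (\<lambda>\<omega>. D (x (Suc k) \<omega>))" if k: "k \<in> {1..K}" for k
  proof (rule Bochner_Integration.integrable_bound)
    show "integrable M (\<lambda>\<omega>. R \<omega> / \<psi> k)" using R_int by simp
    show "AE \<omega> in M. norm (D (x (Suc k) \<omega>)) \<le> norm (R \<omega> / \<psi> k)"
    proof (rule AE_I2)
      fix \<omega> assume "\<omega> \<in> space M"
      have "\<psi> k * D (x (Suc k) \<omega>) \<le> (\<Sum>k=1..K. \<psi> k * D (x (Suc k) \<omega>))"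
        using k D_nonneg less_imp_le[OF \<psi>]
        by (intro member_le_sum[of k _ "\<lambda>k. \<psi> k * D (x (Suc k) \<omega>)"]) (auto intro!: mult_nonneg_nonneg)
      also have "\<dots> \<le> R \<omega>" by (rule path) fact
      finally have "D (x (Suc k) \<omega>) \<le> R \<omega> / \<psi> k"
        using \<psi>[OF k] by (simp add: pos_le_divide_eq mult.commute)
      then show "norm (D (x (Suc k) \<omega>)) \<le> norm (R \<omega> / \<psi> k)"
        using D_nonneg[of "x (Suc k) \<omega>"] unfolding real_norm_def by linarith
    qed
  qed (rule D_M[OF k])

  \<comment> \<open>Averaging over the random output index\<close>
  let ?I = "\<lambda>k \<omega>. indicator {k} (Y \<omega>) :: real"
  have mix: "integrable M (\<lambda>\<omega>. ?I k \<omega> * D (x (Suc k) \<omega>)) \<and>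
      expectation (\<lambda>\<omega>. ?I k \<omega> * D (x (Suc k) \<omega>)) = \<psi> k / \<Psi> * expectation (\<lambda>\<omega>. D (x (Suc k) \<omega>))"
    if k: "k \<in> {1..K}" for k
  proof -
    \<comment> \<open>\<open>x (Suc k)\<close> uses the samples of round \<open>k\<close> as well,
      hence \<open>past (Suc k)\<close>.\<close>
    have sig: "indep_set (sigma_sets (space M) (\<Union>s\<in>{Output_Index}. E s))
        (sigma_sets (space M) (\<Union>s\<in>past (Suc k). E s))"
      using past_all stable
      by (intro indep_set_sigma_Un indep_sets_mono_index[OF _ indepE]) (auto simp: past_def all_def)
    have ind: "indep_var borel (?I k) borel (\<lambda>\<omega>. D (x (Suc k) \<omega>))"
    proof (rule indep_var_of_sigma[OF sig])
      show "?I k \<in> borel_measurable (sigma (space M) (\<Union>s\<in>{Output_Index}. E s))"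
        using Y_H unfolding H_def by (rule measurable_compose) simp
      show "(\<lambda>\<omega>. D (x (Suc k) \<omega>)) \<in> borel_measurable (sigma (space M) (\<Union>s\<in>past (Suc k). E s))"
        using x_H[of "Suc k"] k unfolding H_def by (intro measurable_compose[OF _ D_meas]) simp
    qed
    have Yk: "{\<omega> \<in> space M. Y \<omega> = k} \<in> events"
      using measurable_sets[OF Y, of "{k}"] k by (simp add: vimage_def Int_def conj_commute)
    have I_eq: "?I k \<omega> = indicator {\<omega> \<in> space M. Y \<omega> = k} \<omega>" if "\<omega> \<in> space M" for \<omega>
      using that by (simp add: indicator_def)
    have "integrable M (?I k)" "expectation (?I k) = \<psi> k / \<Psi>"
      using Yk PY[OF k] by (simp_all add: I_eq \<Psi>_def less_top[symmetric]
        cong: Bochner_Integration.integrable_cong Bochner_Integration.integral_cong)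
    then show ?thesis
      using indep_var_lebesgue_integral[OF ind _ D_int[OF k]] indep_var_integrable[OF ind _ D_int[OF k]]
      by simp
  qed
  have out: "infdist0 (frechet_subdiff (\<lambda>y. ereal (f y) + delta X y) (x (Y \<omega> + 1) \<omega>)) =
      (\<Sum>k=1..K. ?I k \<omega> * D (x (Suc k) \<omega>))" if \<omega>: "\<omega> \<in> space M" for \<omega>
  proof -
    have Yk: "Y \<omega> \<in> {1..K}" using measurable_space[OF Y \<omega>] by simp
    then have "(\<Sum>k=1..K. ?I k \<omega> * D (x (Suc k) \<omega>)) = D (x (Suc (Y \<omega>)) \<omega>)"
      by (simp add: indicator_def of_bool_def if_distrib[of "\<lambda>t. t * _"] sum.delta' cong: if_cong)
    then show ?thesis using D_eq[OF xX[OF _ \<omega>, of "Y \<omega> + 1"]] Yk by simp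
  qed
  have "integrable M (\<lambda>\<omega>. \<Sum>k=1..K. ?I k \<omega> * D (x (Suc k) \<omega>))"
    by (intro Bochner_Integration.integrable_sum conjunct1[OF mix])
  then have out_int: "integrable M
      (\<lambda>\<omega>. infdist0 (frechet_subdiff (\<lambda>y. ereal (f y) + delta X y) (x (Y \<omega> + 1) \<omega>)))"
    by (subst Bochner_Integration.integrable_cong[OF refl out])

  \<comment> \<open>Assembling the expected bound\<close>
  have "(LINT \<omega>|M. infdist0 (frechet_subdiff (\<lambda>y. ereal (f y) + delta X y) (x (Y \<omega> + 1) \<omega>)))
      = expectation (\<lambda>\<omega>. \<Sum>k=1..K. ?I k \<omega> * D (x (Suc k) \<omega>))"
    by (intro Bochner_Integration.integral_cong refl out)
  also have "\<dots> = (\<Sum>k=1..K. expectation (\<lambda>\<omega>. ?I k \<omega> * D (x (Suc k) \<omega>)))"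
    by (intro Bochner_Integration.integral_sum conjunct1[OF mix])
  also have "\<dots> = (\<Sum>k=1..K. \<psi> k / \<Psi> * expectation (\<lambda>\<omega>. D (x (Suc k) \<omega>)))"
    by (intro sum.cong refl conjunct2[OF mix])
  \<comment> \<open>Output probabilities proportional to the radii produce exactly the weighted sum
    that \<open>path\<close> controls.\<close>
  also have "\<dots> = expectation (\<lambda>\<omega>. \<Sum>k=1..K. \<psi> k * D (x (Suc k) \<omega>)) / \<Psi>"
    using D_int by (simp add: sum_divide_distrib)
  also have "\<dots> \<le> expectation R / \<Psi>"
    using \<open>\<Psi> > 0\<close> D_int R_int path by (intro divide_right_mono integral_mono) auto
  also have "expectation R = ((LINT \<omega>|M. f (x 1 \<omega>)) - f_low) + c * (\<Sum>k=1..K. (\<psi> k)\<^sup>2) +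
      2 * (\<Sum>k=1..K. \<psi> k * expectation (\<delta> k))"
  proof -
    have \<psi>\<delta>: "integrable M (\<lambda>\<omega>. \<psi> k * \<delta> k \<omega>)" if "k \<in> {1..K}" for k
      using noise[OF that] by simp
    then have "integrable M (\<lambda>\<omega>. \<Sum>k=1..K. \<psi> k * \<delta> k \<omega>)"
      by (rule Bochner_Integration.integrable_sum)
    moreover have "expectation (\<lambda>\<omega>. \<Sum>k=1..K. \<psi> k * \<delta> k \<omega>) = (\<Sum>k=1..K. \<psi> k * expectation (\<delta> k))"
      by (subst Bochner_Integration.integral_sum[OF \<psi>\<delta>]) simp_all
    ultimately show ?thesis
      unfolding R_def using assms(25) by (simp add: prob_space)
  qed
  also have "(\<Sum>k=1..K. \<psi> k * expectation (\<delta> k)) \<le>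
      (\<Sum>k=1..K. \<psi> k / sqrt (m k)) * sqrt ((exp 1)\<^sup>2 * ln (real CARD('n)) * sigma_sq)"
    unfolding sum_distrib_right
  proof (rule sum_mono)
    fix k assume k: "k \<in> {1..K}"
    \<comment> \<open>The smoothing constant \<open>2 * ln (2 * CARD('n))\<close> is exchanged for
      \<open>(exp 1)\<^sup>2 * ln CARD('n)\<close>, which relies on dimension at least 2.\<close>
    have "C k \<le> sqrt ((exp 1)\<^sup>2 * ln CARD('n) * sigma_sq / m k)"
      unfolding C_def using two_ln_double_le[of "CARD('n)"] assms(1) \<open>sigma_sq \<ge> 0\<close>
      by (intro real_sqrt_le_mono divide_right_mono mult_right_mono) auto
    with noise[OF k] have "expectation (\<delta> k) \<le> sqrt ((exp 1)\<^sup>2 * ln CARD('n) * sigma_sq) / sqrt (m k)"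
      by (simp add: real_sqrt_divide)
    then have "\<psi> k * expectation (\<delta> k) \<le> \<psi> k * (sqrt ((exp 1)\<^sup>2 * ln CARD('n) * sigma_sq) / sqrt (m k))"
      using \<psi>[OF k] by (intro mult_left_mono) auto
    then show "\<psi> k * expectation (\<delta> k) \<le> \<psi> k / sqrt (m k) * sqrt ((exp 1)\<^sup>2 * ln CARD('n) * sigma_sq)"
      by simp
  qed
  finally have bound: "(LINT \<omega>|M. infdist0 (frechet_subdiff (\<lambda>y. ereal (f y) + delta X y) (x (Y \<omega> + 1) \<omega>)))
      \<le> ((LINT \<omega>|M. f (x 1 \<omega>)) - f_low + c * (\<Sum>k=1..K. (\<psi> k)\<^sup>2) +
          2 * ((\<Sum>k=1..K. \<psi> k / sqrt (m k)) * sqrt ((exp 1)\<^sup>2 * ln (real CARD('n)) * sigma_sq))) / \<Psi>"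
    using \<open>\<Psi> > 0\<close> by (simp add: divide_right_mono)
  have "(a + c * b + 2 * (d * e)) / \<Psi> = c * (b / \<Psi>) + a / \<Psi> + 2 * d / \<Psi> * e" for a b d e
    by (simp add: add_divide_distrib)
  then show ?thesis
    using bound out_int unfolding \<Psi>_def c_def by simp
qed

end
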